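(* Let $V$ be a finite-dimensional real vector space with a positive definite symmetric bilinear form $\langle\,,\rangle$, let $M\subset V$ be a lattice, and let $W\subset \mathrm{GL}(V)$ be a finite reflection group preserving $M$. Let $D$ be the fundamental domain of $W$ associated to a simple system $\Delta$ of $W$. If $S\subset M$ is a saturated affine semigroup with $w(S)=S$ for all $w\in W$, then there is a ring isomorphism $\mathbb{Z}[D\cap S]\to \mathbb{Z}[S]^W$. Equivalently, the quotient $\operatorname{Spec}\mathbb{Z}[S]/W=\operatorname{Spec}(\mathbb{Z}[S]^W)$ is isomorphic to the normal affine toric variety $\operatorname{Spec}\mathbb{Z}[D\cap S]$.
   Context: A lattice in $V$ is the $\mathbb{Z}$-span of a basis of $V$. For nonzero $\alpha\in V$, the reflection $s_\alpha$ is $s_\alpha(v)=v-2\frac{\langle v,\alpha\rangle}{\langle\alpha,\alpha\rangle}\alpha$; a (finite) reflection group is a finite subgroup of $\mathrm{GL}(V)$ generated by such reflections. A root system is a finite set $\Phi\subset V$ such that for all $\alpha\in\Phi$, $\Phi\cap\mathbb{R}\alpha=\{\alpha,-\alpha\}$ and $s_\alpha(\Phi)=\Phi$; every finite reflection group $W$ is generated by $\{s_\alpha:\alpha\in\Phi\}$ for some root system $\Phi$. A simple system is a linearly independent subset $\Delta=\{\alpha_1,\dots,\alpha_r\}\subset\Phi$ spanning the same subspace as $\Phi$ such that every element of $\Phi$ is a real linear combination of elements of $\Delta$ with coefficients all of the same sign. The associated fundamental domain is $D=\{v\in V:\langle v,\alpha_i\rangle\ge 0,\ 1\le i\le r\}$.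 A saturated affine semigroup is a finitely generated $\mathbb{Z}_{\ge0}$-submodule $S\subset M$ such that for all $k\in\mathbb{Z}_{>0}$ and $m\in M$, $km\in S$ implies $m\in S$. For a semigroup $S$, $\mathbb{Z}[S]$ is the semigroup ring with $\mathbb{Z}$-basis $\{\chi^s:s\in S\}$ and $\chi^s\chi^t=\chi^{s+t}$; $W$ acts on $\mathbb{Z}[S]$ by $w\chi^s=\chi^{ws}$, and $\mathbb{Z}[S]^W$ denotes the invariants. *)

theory Defs
  imports "HOL-Analysis.Analysis" "HOL-Library.Poly_Mapping"
begin

definition reflection :: "'a::real_inner \<Rightarrow> 'a \<Rightarrow> 'a" where
  "reflection \<alpha> v = v - (2 * (v \<bullet> \<alpha>) / (\<alpha> \<bullet> \<alpha>)) *\<^sub>R \<alpha>"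

definition is_lattice :: "'a::euclidean_space set \<Rightarrow> bool" where
  "is_lattice M \<longleftrightarrow> (\<exists>B. independent B \<and> span B = UNIV \<and>
      M = {v. \<exists>c::'a \<Rightarrow> int. v = (\<Sum>b\<in>B. of_int (c b) *\<^sub>R b)})"

text \<open>Subgroup of the transformation monoid generated by a set of maps
  (for finite groups of bijections, closure under composition and identity suffices).\<close>
inductive_set gen_group :: "('a \<Rightarrow> 'a) set \<Rightarrow> ('a \<Rightarrow> 'a) set" for G where
  gen_id: "id \<in> gen_group G"
| gen_comp: "g \<in> G \<Longrightarrow> h \<in> gen_group G \<Longrightarrow> g \<circ> h \<in> gen_group G"

definition root_system :: "'a::euclidean_space set \<Rightarrow> bool" where
  "root_system \<Phi> \<longleftrightarrow> finite \<Phi> \<and> 0 \<notin> \<Phi> \<and>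
     (\<forall>\<alpha>\<in>\<Phi>. \<Phi> \<inter> {c *\<^sub>R \<alpha> | c. True} = {\<alpha>, -\<alpha>} \<and> reflection \<alpha> ` \<Phi> = \<Phi>)"

definition simple_system :: "'a::euclidean_space set \<Rightarrow> 'a set \<Rightarrow> bool" where
  "simple_system \<Phi> \<Delta> \<longleftrightarrow> \<Delta> \<subseteq> \<Phi> \<and> independent \<Delta> \<and> span \<Delta> = span \<Phi> \<and>
     (\<forall>\<beta>\<in>\<Phi>. \<exists>c::'a \<Rightarrow> real. \<beta> = (\<Sum>\<alpha>\<in>\<Delta>. c \<alpha> *\<^sub>R \<alpha>) \<and>
        ((\<forall>\<alpha>\<in>\<Delta>. c \<alpha> \<ge> 0) \<or> (\<forall>\<alpha>\<in>\<Delta>. c \<alpha> \<le> 0)))"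

definition fundamental_domain :: "'a::euclidean_space set \<Rightarrow> 'a set" where
  "fundamental_domain \<Delta> = {v. \<forall>\<alpha>\<in>\<Delta>. v \<bullet> \<alpha> \<ge> 0}"

definition saturated_affine_semigroup :: "'a::euclidean_space set \<Rightarrow> 'a set \<Rightarrow> bool" where
  "saturated_affine_semigroup M S \<longleftrightarrow> S \<subseteq> M \<and>
     (\<exists>G. finite G \<and> S = {v. \<exists>n::'a \<Rightarrow> nat. v = (\<Sum>g\<in>G. of_nat (n g) *\<^sub>R g)}) \<and>
     (\<forall>k::nat. \<forall>m\<in>M. k > 0 \<longrightarrow> of_nat k *\<^sub>R m \<in> S \<longrightarrow> m \<in> S)"

text \<open>Semigroup ring Z[S]: finitely supported Z-valued functions on V with support in S,
  chi^s = Poly_Mapping.single s 1; multiplication is convolution (chi^s chi^t = chi^(s+t)).\<close>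
definition semigroup_ring :: "'a::comm_monoid_add set \<Rightarrow> ('a \<Rightarrow>\<^sub>0 int) set" where
  "semigroup_ring S = {f. Poly_Mapping.keys f \<subseteq> S}"

definition act :: "('a \<Rightarrow> 'a) \<Rightarrow> ('a \<Rightarrow>\<^sub>0 int) \<Rightarrow> ('a \<Rightarrow>\<^sub>0 int)" where
  "act w f = (\<Sum>s\<in>Poly_Mapping.keys f. Poly_Mapping.single (w s) (Poly_Mapping.lookup f s))"

definition invariants :: "('a \<Rightarrow> 'a) set \<Rightarrow> ('a::comm_monoid_add \<Rightarrow>\<^sub>0 int) set \<Rightarrow> ('a \<Rightarrow>\<^sub>0 int) set" where
  "invariants W R = {f \<in> R. \<forall>w\<in>W. act w f = f}"

definition ring_iso_betw :: "('r::ring_1 \<Rightarrow> 's::ring_1) \<Rightarrow> 'r set \<Rightarrow> 's set \<Rightarrow> bool" where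
  "ring_iso_betw \<phi> A B \<longleftrightarrow> bij_betw \<phi> A B \<and> \<phi> 1 = 1 \<and>
     (\<forall>x\<in>A. \<forall>y\<in>A. \<phi> (x + y) = \<phi> x + \<phi> y \<and> \<phi> (x * y) = \<phi> x * \<phi> y)"

end

theory Submission
  imports Defs
begin

text \<open>
  Rescale every simple root to the primitive vector \<open>a\<close> of \<open>M\<close> on its ray. Then
  \<open>\<langle>m, a\<^sup>\<or>\<rangle>\<close> is an integer for all \<open>m \<in> M\<close>, so the rescaled simple system is crystallographic and
  every \<open>m \<in> D \<inter> S\<close> is \<open>m\<^sub>0 + \<Sum>\<^sub>a \<langle>m, a\<^sup>\<or>\<rangle> \<omega>\<^sub>a\<close> with \<open>m\<^sub>0\<close> fixed by \<open>W\<close> and natural coefficients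
  at the fundamental weights. The isomorphism sends \<open>\<chi>\<^sup>m\<close> to \<open>\<chi>\<close> of \<open>m\<^sub>0\<close> times the
  product of the powers of the orbit sums of the \<open>\<omega>\<^sub>a\<close>. This element has leading term \<open>\<chi>\<^sup>m\<close> for the
  order in which \<open>x\<close> lies below \<open>m\<close> if \<open>m - x\<close> is a natural combination of simple roots.
  A dominant vector below \<open>m\<close> is reached from \<open>m\<close> by successively subtracting simple roots without
  leaving \<open>S\<close>, because \<open>S\<close> is saturated and \<open>W\<close>-invariant; hence the image lies in the semigroup
  ring of \<open>S\<close>. Distinct dominant vectors below \<open>m\<close> are shorter than \<open>m\<close>, and \<open>M\<close> is discrete, so the map
  is unitriangular with respect to the norm, hence bijective onto the invariants.
\<close>

subsection \<open>Reflections and the groups they generate\<close>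

lemma reflection_zero [simp]: "reflection 0 = id"
  by (auto simp: reflection_def)

lemma reflection_scaleR:
  assumes "c \<noteq> 0"
  shows "reflection (c *\<^sub>R a) = reflection a"
  using assms by (auto simp: reflection_def fun_eq_iff)

lemma linear_reflection: "linear (reflection a)"
  by (rule linearI) (auto simp: reflection_def algebra_simps add_divide_distrib)

lemma reflection_involution [simp]: "reflection a (reflection a v) = v"
proof (cases "a = 0")
  case False
  then show ?thesis
    by (simp add: reflection_def inner_diff_left scaleR_diff_left[symmetric] field_simps)
qed simp

lemma orthogonal_reflection: "orthogonal_transformation (reflection (a :: 'a::euclidean_space))"
  unfolding orthogonal_transformation_def
proof (intro conjI allI linear_reflection)
  fix v w
  show "reflection a v \<bullet> reflection a w = v \<bullet> w"
    by (cases "a = 0") (auto simp: reflection_def inner_diff_left inner_diff_right inner_commute field_simps)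
qed

lemma reflection_conjugate:
  fixes w :: "'a::euclidean_space \<Rightarrow> 'a"
  assumes "orthogonal_transformation w"
  shows "w (reflection a v) = reflection (w a) (w v)"
  using assms
  by (simp add: reflection_def orthogonal_transformation_def linear_diff linear_scale)

lemma gen_group_base: "g \<in> G \<Longrightarrow> g \<in> gen_group G"
  using gen_group.gen_comp[OF _ gen_group.gen_id] by fastforce

lemma gen_group_compose:
  assumes "g \<in> gen_group G" "h \<in> gen_group G"
  shows "g \<circ> h \<in> gen_group G"
  using assms by (induction rule: gen_group.induct) (auto simp: comp_assoc intro: gen_group.intros)

lemma gen_group_mono:
  assumes "G \<subseteq> gen_group H"
  shows "gen_group G \<subseteq> gen_group H"
proof
  fix g assume "g \<in> gen_group G"
  then show "g \<in> gen_group H"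
    using assms by induction (auto intro: gen_group.gen_id gen_group_compose)
qed

lemma gen_group_reflection_orthogonal:
  fixes R :: "'a::euclidean_space set"
  assumes "w \<in> gen_group (reflection ` R)"
  shows "orthogonal_transformation w"
  using assms
proof induction
  case gen_id
  then show ?case by (simp add: id_def)
next
  case (gen_comp g h)
  then obtain a where "g = reflection a" by blast
  then show ?case
    using orthogonal_transformation_compose[OF orthogonal_reflection gen_comp.IH] by metis
qed

text \<open>\<open>gen_group\<close> is only closed under composition, but reflections are
  involutions, so reversing a word in them inverts it.\<close>

lemma gen_group_reflection_inverse:
  fixes R :: "'a::euclidean_space set"
  assumes "w \<in> gen_group (reflection ` R)"
  obtains u where "u \<in> gen_group (reflection ` R)" "\<And>v. u (w v) = v" "\<And>v. w (u v) = v"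
proof -
  have "\<exists>u\<in>gen_group (reflection ` R). (\<forall>v. u (w v) = v) \<and> (\<forall>v. w (u v) = v)"
    using assms
  proof induction
    case gen_id
    then show ?case by (auto intro: bexI[of _ id] gen_group.gen_id)
  next
    case (gen_comp g h)
    then obtain a u where "a \<in> R" "g = reflection a"
      "u \<in> gen_group (reflection ` R)" "\<forall>v. u (h v) = v" "\<forall>v. h (u v) = v"
      by auto
    moreover from this have "u \<circ> reflection a \<in> gen_group (reflection ` R)"
      by (intro gen_group_compose) (auto intro: gen_group_base)
    ultimately show ?case
      by (intro bexI[of _ "u \<circ> reflection a"]) auto
  qed
  then show ?thesis using that by blast
qed

subsection \<open>Dual families\<close>

text \<open>The coordinate functionals of \<open>B\<close> extend linearly to the whole space and
  are represented by vectors through the adjoint. If \<open>B\<close> does not span, the family is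
  not unique.\<close>

lemma dual_family_exists:
  fixes B :: "'a::euclidean_space set"
  assumes "independent B"
  obtains d where "\<And>a b. a \<in> B \<Longrightarrow> b \<in> B \<Longrightarrow> b \<bullet> d a = (if a = b then 1 else 0)"
proof -
  have "\<exists>e. \<forall>b\<in>B. b \<bullet> e = (if a = b then 1 else 0)" for a
  proof -
    obtain f :: "'a \<Rightarrow> real" where f: "linear f" "\<And>b. b \<in> B \<Longrightarrow> f b = (if a = b then 1 else 0)"
      using linear_independent_extend[OF assms, of "\<lambda>b. if a = b then 1 else 0"] by blast
    have "b \<bullet> adjoint f 1 = f b" for b
      using adjoint_works[OF f(1), of b 1] by simp
    then show ?thesis using f(2) by (intro exI[of _ "adjoint f 1"]) simp
  qed
  then show ?thesis using that by metis
qed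

subsection \<open>Natural cones and simple roots\<close>

text \<open>The pairing of \<open>v\<close> with the coroot of \<open>a\<close>. It is linear in
  \<open>v\<close>, while rescaling \<open>a\<close> by \<open>t\<close> divides it by
  \<open>t\<close>.\<close>

definition pairing :: "'a::real_inner \<Rightarrow> 'a \<Rightarrow> real" where
  "pairing v a = 2 * (v \<bullet> a) / (a \<bullet> a)"

lemma reflection_pairing: "reflection a v = v - pairing v a *\<^sub>R a"
  by (simp add: reflection_def pairing_def)

lemma pairing_zero [simp]: "pairing 0 a = 0"
  by (simp add: pairing_def)

lemma pairing_add: "pairing (u + v) a = pairing u a + pairing v a"
  by (simp add: pairing_def inner_add_left add_divide_distrib algebra_simps)

lemma pairing_diff: "pairing (u - v) a = pairing u a - pairing v a"
  by (simp add: pairing_def inner_diff_left diff_divide_distrib algebra_simps)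

lemma pairing_scaleR: "pairing (c *\<^sub>R u) a = c * pairing u a"
  by (simp add: pairing_def)

lemma pairing_sum: "pairing (sum f A) a = (\<Sum>i\<in>A. pairing (f i) a)"
  by (simp add: pairing_def inner_sum_left sum_distrib_left sum_divide_distrib)

lemma pairing_nonneg_iff: "a \<noteq> 0 \<Longrightarrow> pairing v a \<ge> 0 \<longleftrightarrow> v \<bullet> a \<ge> 0"
  using inner_gt_zero_iff[of a]
  by (auto simp: pairing_def zero_le_divide_iff zero_le_mult_iff simp del: inner_gt_zero_iff)

text \<open>Serves two purposes: over the simple roots it defines the dominance order, and over a
  finite generating set it is the affine semigroup itself.\<close>

definition nat_cone :: "'a::real_vector set \<Rightarrow> 'a set" where
  "nat_cone B = {v. \<exists>n::'a \<Rightarrow> nat. v = (\<Sum>b\<in>B. of_nat (n b) *\<^sub>R b)}"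

lemma nat_cone_zero: "0 \<in> nat_cone B"
  unfolding nat_cone_def by (auto intro!: exI[of _ "\<lambda>_. 0"])

lemma nat_cone_add: "x \<in> nat_cone B \<Longrightarrow> y \<in> nat_cone B \<Longrightarrow> x + y \<in> nat_cone B"
proof -
  assume "x \<in> nat_cone B" "y \<in> nat_cone B"
  then obtain n m :: "'a \<Rightarrow> nat" where
    "x = (\<Sum>b\<in>B. of_nat (n b) *\<^sub>R b)" "y = (\<Sum>b\<in>B. of_nat (m b) *\<^sub>R b)"
    unfolding nat_cone_def by blast
  then have "x + y = (\<Sum>b\<in>B. of_nat (n b + m b) *\<^sub>R b)"
    by (simp add: sum.distrib scaleR_add_left)
  then show ?thesis unfolding nat_cone_def by (intro CollectI exI[of _ "\<lambda>b. n b + m b"])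
qed

lemma nat_cone_scale: "x \<in> nat_cone B \<Longrightarrow> of_nat k *\<^sub>R x \<in> nat_cone B"
  by (induction k) (auto simp: scaleR_add_left nat_cone_zero intro: nat_cone_add)

lemma nat_cone_base:
  assumes "finite B" "b \<in> B"
  shows "b \<in> nat_cone B"
proof -
  have "(\<Sum>c\<in>B. of_nat (if c = b then 1 else 0) *\<^sub>R c) = (\<Sum>c\<in>B. if c = b then c else 0)"
    by (rule sum.cong) auto
  then have "b = (\<Sum>c\<in>B. of_nat (if c = b then 1 else 0) *\<^sub>R c)"
    using assms by simp
  then show ?thesis unfolding nat_cone_def by (intro CollectI exI)
qed

section \<open>Words in simple reflections, exchange and dominance\<close>

fun word :: "'a::real_inner list \<Rightarrow> 'a \<Rightarrow> 'a" where
  "word [] = id"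
| "word (a # as) = reflection a \<circ> word as"

lemma word_append: "word (as @ bs) = word as \<circ> word bs"
  by (induction as) auto

lemma word_in_gen_group: "set as \<subseteq> B \<Longrightarrow> word as \<in> gen_group (reflection ` B)"
  by (induction as) (auto intro: gen_group.intros)

lemma gen_group_reflection_word:
  assumes "w \<in> gen_group (reflection ` B)"
  obtains as where "set as \<subseteq> B" "w = word as"
proof -
  have "\<exists>as. set as \<subseteq> B \<and> w = word as"
    using assms
  proof induction
    case gen_id
    then show ?case by (intro exI[of _ "[]"]) simp
  next
    case (gen_comp g h)
    then obtain a as where "a \<in> B" "g = reflection a" "set as \<subseteq> B" "h = word as" by auto
    then show ?case by (intro exI[of _ "a # as"]) simp
  qed
  then show ?thesis using that by blast
qed

text \<open>The root system enters only through \<open>signed\<close>: images of simple roots under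
  \<open>W\<close> have integer coefficients of one sign. The simple roots may span a proper
  subspace.\<close>

locale simple_roots =
  fixes \<Delta> :: "'a::euclidean_space set" and W :: "('a \<Rightarrow> 'a) set"
  assumes indep: "independent \<Delta>"
    and W_eq: "W = gen_group (reflection ` \<Delta>)"
    and finite_W: "finite W"
    and signed: "w \<in> W \<Longrightarrow> a \<in> \<Delta> \<Longrightarrow> w a \<in> nat_cone \<Delta> \<or> - w a \<in> nat_cone \<Delta>"
begin

lemma finite_simple: "finite \<Delta>"
  using indep by (simp add: independent_imp_finite)

lemma simple_nonzero: "a \<in> \<Delta> \<Longrightarrow> a \<noteq> 0"
  using indep dependent_zero by blast

definition dual :: "'a \<Rightarrow> 'a" where
  "dual = (SOME d. \<forall>a\<in>\<Delta>. \<forall>b\<in>\<Delta>. b \<bullet> d a = (if a = b then 1 else 0))"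

lemma inner_dual: "a \<in> \<Delta> \<Longrightarrow> b \<in> \<Delta> \<Longrightarrow> b \<bullet> dual a = (if a = b then 1 else 0)"
proof -
  obtain d where d: "\<And>a b. a \<in> \<Delta> \<Longrightarrow> b \<in> \<Delta> \<Longrightarrow> b \<bullet> d a = (if a = b then 1 else 0)"
    using dual_family_exists[OF indep] by blast
  have "\<forall>a\<in>\<Delta>. \<forall>b\<in>\<Delta>. b \<bullet> dual a = (if a = b then 1 else 0)"
    unfolding dual_def by (rule someI[of _ d]) (intro ballI d)
  then show "a \<in> \<Delta> \<Longrightarrow> b \<in> \<Delta> \<Longrightarrow> b \<bullet> dual a = (if a = b then 1 else 0)"
    by simp
qed

lemma combination_inner_dual:
  assumes "a \<in> \<Delta>"
  shows "(\<Sum>b\<in>\<Delta>. c b *\<^sub>R b) \<bullet> dual a = c a"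
proof -
  have "(\<Sum>b\<in>\<Delta>. c b *\<^sub>R b) \<bullet> dual a = (\<Sum>b\<in>\<Delta>. if b = a then c b else 0)"
    unfolding inner_sum_left by (rule sum.cong) (use assms in \<open>auto simp: inner_dual\<close>)
  then show ?thesis using assms finite_simple by simp
qed

lemma cone_coefficients:
  assumes "x \<in> nat_cone \<Delta>"
  shows "x = (\<Sum>a\<in>\<Delta>. (x \<bullet> dual a) *\<^sub>R a)" and "a \<in> \<Delta> \<Longrightarrow> x \<bullet> dual a \<in> \<nat>"
proof -
  obtain n :: "'a \<Rightarrow> nat" where n: "x = (\<Sum>a\<in>\<Delta>. of_nat (n a) *\<^sub>R a)"
    using assms unfolding nat_cone_def by blast
  then have *: "a \<in> \<Delta> \<Longrightarrow> x \<bullet> dual a = of_nat (n a)" for a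
    by (simp add: combination_inner_dual)
  show "x = (\<Sum>a\<in>\<Delta>. (x \<bullet> dual a) *\<^sub>R a)"
    by (subst n, rule sum.cong) (auto simp: *)
  show "a \<in> \<Delta> \<Longrightarrow> x \<bullet> dual a \<in> \<nat>" by (simp add: *)
qed

lemma cone_coefficient_nonneg: "x \<in> nat_cone \<Delta> \<Longrightarrow> a \<in> \<Delta> \<Longrightarrow> x \<bullet> dual a \<ge> 0"
  using cone_coefficients(2) Nats_altdef2 by fastforce

lemma cone_pointed:
  assumes "x \<in> nat_cone \<Delta>" "- x \<in> nat_cone \<Delta>"
  shows "x = 0"
proof -
  have "x \<bullet> dual a = 0" if "a \<in> \<Delta>" for a
    using cone_coefficient_nonneg[OF assms(1) that] cone_coefficient_nonneg[OF assms(2) that] by simp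
  then show ?thesis using cone_coefficients(1)[OF assms(1)] by simp
qed

lemma W_orthogonal: "w \<in> W \<Longrightarrow> orthogonal_transformation w"
  using W_eq gen_group_reflection_orthogonal by blast

lemma W_linear: "w \<in> W \<Longrightarrow> linear w"
  using W_orthogonal orthogonal_transformation_linear by blast

lemma W_inverse:
  assumes "w \<in> W"
  obtains u where "u \<in> W" "\<And>v. u (w v) = v" "\<And>v. w (u v) = v"
  using assms gen_group_reflection_inverse unfolding W_eq by metis

lemma W_reflection: "a \<in> \<Delta> \<Longrightarrow> reflection a \<in> W"
  unfolding W_eq by (auto intro: gen_group_base)

lemma W_compose: "u \<in> W \<Longrightarrow> w \<in> W \<Longrightarrow> u \<circ> w \<in> W"
  unfolding W_eq by (rule gen_group_compose)

lemma W_id: "id \<in> W"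
  unfolding W_eq by (rule gen_group.gen_id)

lemma W_word: "set as \<subseteq> \<Delta> \<Longrightarrow> word as \<in> W"
  unfolding W_eq by (rule word_in_gen_group)

text \<open>Apply the letters of the word to \<open>a\<close> from right to left. Where the image
  first turns negative, the letter \<open>b\<close> makes a positive vector \<open>v\<close>
  negative, so \<open>v\<close> is a multiple of \<open>b\<close>. The reflections in
  \<open>v\<close> and \<open>b\<close> then agree, and the letter can be deleted.\<close>

lemma exchange_condition:
  assumes "a \<in> \<Delta>" "set as \<subseteq> \<Delta>" "- word as a \<in> nat_cone \<Delta>"
  shows "\<exists>bs. set bs \<subseteq> \<Delta> \<and> length bs < length as \<and> word as \<circ> reflection a = word bs"
  using assms(2,3)
proof (induction as)
  case Nil
  then have "a = 0"
    using cone_pointed nat_cone_base[OF finite_simple] assms(1) by auto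
  then show ?case using simple_nonzero assms(1) by blast
next
  case (Cons b as)
  define v where "v = word as a"
  have b: "b \<in> \<Delta>" and as: "set as \<subseteq> \<Delta>" using Cons.prems by auto
  note orth = W_orthogonal[OF W_word[OF as]]
  show ?case
  proof (cases "- v \<in> nat_cone \<Delta>")
    case True
    then obtain bs where "set bs \<subseteq> \<Delta>" "length bs < length as" "word as \<circ> reflection a = word bs"
      using Cons.IH[OF as] v_def by blast
    then show ?thesis
      using b by (intro exI[of _ "b # bs"]) (auto simp: fun_eq_iff)
  next
    case False
    then have v: "v \<in> nat_cone \<Delta>" using signed[OF W_word[OF as] assms(1)] v_def by blast
    have neg: "- reflection b v \<in> nat_cone \<Delta>" using Cons.prems v_def by simp
    \<comment> \<open>\<open>reflection b\<close> changes only the coefficient at \<open>b\<close>,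
      so every other coefficient is both nonnegative and nonpositive.\<close>
    have "v \<bullet> dual c = 0" if c: "c \<in> \<Delta>" "c \<noteq> b" for c
      using cone_coefficient_nonneg[OF v c(1)] cone_coefficient_nonneg[OF neg c(1)] c b
      by (simp add: reflection_pairing inner_diff_left inner_dual)
    then have "v = (\<Sum>c\<in>\<Delta>. if c = b then (v \<bullet> dual b) *\<^sub>R b else 0)"
      by (subst cone_coefficients(1)[OF v], intro sum.cong) auto
    then have v_eq: "v = (v \<bullet> dual b) *\<^sub>R b" using b finite_simple by simp
    have "v \<noteq> 0"
      using orth simple_nonzero[OF assms(1)]
      by (metis norm_eq_zero orthogonal_transformation_norm v_def)
    then have "v \<bullet> dual b \<noteq> 0" using v_eq by force
    then have "reflection v = reflection b" by (metis v_eq reflection_scaleR)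
    \<comment> \<open>Composing with \<open>reflection b\<close> on the left cancels it, which
      leaves \<open>word as\<close>, shorter by one letter.\<close>
    then have "word as (reflection a x) = reflection b (word as x)" for x
      using reflection_conjugate[OF orth] v_def by simp
    then show ?thesis using as by (intro exI[of _ as]) (auto simp: fun_eq_iff)
  qed
qed

text \<open>Induction on the length of a word for \<open>w\<close>. If its last letter is
  \<open>a\<close> and \<open>u\<close> is the rest, then \<open>x - w x\<close> is
  \<open>x - u x\<close> plus a natural multiple of \<open>u a\<close>. When \<open>u a\<close> is
  negative, the exchange condition replaces the word by a shorter one.\<close>

lemma dominant_weight_maximal:
  assumes "\<And>a. a \<in> \<Delta> \<Longrightarrow> pairing x a \<in> \<nat>" "w \<in> W"
  shows "x - w x \<in> nat_cone \<Delta>"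
proof -
  have "x - word as x \<in> nat_cone \<Delta>" if "set as \<subseteq> \<Delta>" for as
    using that
  proof (induction as rule: length_induct)
    case (1 as)
    show ?case
    proof (cases as rule: rev_cases)
      case Nil
      then show ?thesis by (simp add: nat_cone_zero)
    next
      case (snoc bs a)
      then have bs: "set bs \<subseteq> \<Delta>" and a: "a \<in> \<Delta>" using 1 by auto
      show ?thesis
      proof (cases "word bs a \<in> nat_cone \<Delta>")
        case True
        obtain k where k: "pairing x a = of_nat k" using assms(1)[OF a] Nats_cases by metis
        have "x - word as x = (x - word bs x) + of_nat k *\<^sub>R word bs a"
          using W_linear[OF W_word[OF bs]]
          by (simp add: snoc word_append reflection_pairing k linear_diff linear_scale)
        moreover have "x - word bs x \<in> nat_cone \<Delta>" using 1 bs snoc by simp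
        ultimately show ?thesis using True by (metis nat_cone_add nat_cone_scale)
      next
        case False
        then have "- word bs a \<in> nat_cone \<Delta>" using signed[OF W_word[OF bs] a] by blast
        then obtain cs where "set cs \<subseteq> \<Delta>" "length cs < length bs" "word as = word cs"
          using exchange_condition[OF a bs] snoc by (auto simp: word_append)
        then show ?thesis using 1 snoc by simp
      qed
    qed
  qed
  then show ?thesis using assms(2) W_eq gen_group_reflection_word by metis
qed

text \<open>Reflecting in \<open>a\<close> lowers the height \<open>\<bullet> rho\<close> by the
  pairing with \<open>a\<close>, since simple roots have height 1. At a point of the finite orbit
  with maximal height, all these pairings are therefore nonnegative.\<close>

lemma dominant_conjugate:
  obtains w where "w \<in> W" "\<And>a. a \<in> \<Delta> \<Longrightarrow> w x \<bullet> a \<ge> 0"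
proof -
  define rho where "rho = (\<Sum>a\<in>\<Delta>. dual a)"
  obtain w where w: "w \<in> W" and max: "\<And>u. u \<in> W \<Longrightarrow> u x \<bullet> rho \<le> w x \<bullet> rho"
    using ex_is_arg_min_if_finite[OF finite_W, of "\<lambda>w. - (w x \<bullet> rho)"] W_id
    by (auto simp: is_arg_min_linorder)
  have "w x \<bullet> a \<ge> 0" if a: "a \<in> \<Delta>" for a
  proof -
    have "a \<bullet> rho = 1"
      unfolding rho_def inner_sum_right using a finite_simple by (simp add: inner_dual)
    moreover have "reflection a (w x) \<bullet> rho \<le> w x \<bullet> rho"
      using max[OF W_compose[OF W_reflection[OF a] w]] by simp
    ultimately have "pairing (w x) a \<ge> 0" by (simp add: reflection_pairing inner_diff_left)
    then show ?thesis using pairing_nonneg_iff simple_nonzero a by blast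
  qed
  then show ?thesis using that w by blast
qed

text \<open>In the expansion of \<open>y \<bullet> y\<close> around \<open>x\<close>, the cross term
  is nonnegative because \<open>x\<close> is dominant, and the square of \<open>y - x\<close> is
  positive.\<close>

lemma norm_less_of_dominance:
  assumes "\<And>a. a \<in> \<Delta> \<Longrightarrow> x \<bullet> a \<ge> 0" "y - x \<in> nat_cone \<Delta>" "x \<noteq> y"
  shows "norm x < norm y"
proof -
  have "x \<bullet> (y - x) = (\<Sum>a\<in>\<Delta>. ((y - x) \<bullet> dual a) * (x \<bullet> a))"
    by (subst cone_coefficients(1)[OF assms(2)]) (simp add: inner_sum_right)
  also have "\<dots> \<ge> 0"
    by (intro sum_nonneg mult_nonneg_nonneg cone_coefficient_nonneg assms)
  finally have "x \<bullet> (y - x) \<ge> 0" .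
  moreover have "(y - x) \<bullet> (y - x) > 0" using assms(3) by simp
  moreover have "y \<bullet> y = x \<bullet> x + 2 * (x \<bullet> (y - x)) + (y - x) \<bullet> (y - x)"
    by (simp add: inner_diff_left inner_diff_right inner_commute)
  ultimately have "x \<bullet> x < y \<bullet> y" by linarith
  then show ?thesis by (simp add: norm_eq_sqrt_inner)
qed

end

subsection \<open>Leading terms in the semigroup ring\<close>

text \<open>Turns scalars into ring elements, so that they can be moved by the ring laws.\<close>

lemma frag_cmul_eq_single: "frag_cmul c f = Poly_Mapping.single 0 c * f"
  for f :: "'a::comm_monoid_add \<Rightarrow>\<^sub>0 int"
  unfolding mult_map_scale_conv_mult[symmetric]
  by (intro poly_mapping_eqI) (simp add: Poly_Mapping.map.rep_eq when_def)

lemma frag_cmul_mult: "frag_cmul c f * frag_cmul d g = frag_cmul (c * d) (f * g)"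
  for f g :: "'a::comm_monoid_add \<Rightarrow>\<^sub>0 int"
proof -
  have "Poly_Mapping.single 0 c * f * (Poly_Mapping.single 0 d * g)
      = (Poly_Mapping.single 0 c * Poly_Mapping.single 0 d) * (f * g)"
    by (simp add: algebra_simps)
  then show ?thesis by (simp add: frag_cmul_eq_single mult_single)
qed

lemma frag_of_mult: "frag_of x * frag_of y = frag_of (x + y)"
  by (simp add: mult_single)

lemma frag_of_zero: "frag_of 0 = 1"
  by (rule single_one)

text \<open>Multiplicativity of \<open>E\<close> is demanded on the supports only, since the map on
  monomials will be multiplicative just for dominant weights.\<close>

lemma frag_extend_mult:
  fixes E :: "'a::comm_monoid_add \<Rightarrow> 'b::comm_monoid_add \<Rightarrow>\<^sub>0 int"
  assumes "\<And>x y. x \<in> Poly_Mapping.keys f \<Longrightarrow> y \<in> Poly_Mapping.keys g \<Longrightarrow> E (x + y) = E x * E y"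
  shows "frag_extend E (f * g) = frag_extend E f * frag_extend E g"
proof -
  let ?f = "Poly_Mapping.lookup f" and ?g = "Poly_Mapping.lookup g"
  let ?K = "Poly_Mapping.keys f" and ?L = "Poly_Mapping.keys g"
  have "f * g = (\<Sum>x\<in>?K. frag_cmul (?f x) (frag_of x)) * (\<Sum>y\<in>?L. frag_cmul (?g y) (frag_of y))"
    by (subst (1) frag_expansion[of f], subst (1) frag_expansion[of g]) (simp only: frag_extend_def)
  also have "\<dots> = (\<Sum>x\<in>?K. \<Sum>y\<in>?L. frag_cmul (?f x * ?g y) (frag_of (x + y)))"
    by (simp add: sum_product frag_cmul_mult frag_of_mult)
  finally have "frag_extend E (f * g) = (\<Sum>x\<in>?K. \<Sum>y\<in>?L. frag_cmul (?f x * ?g y) (E (x + y)))"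
    by (simp add: frag_extend_sum frag_extend_cmul o_def)
  also have "\<dots> = (\<Sum>x\<in>?K. \<Sum>y\<in>?L. frag_cmul (?f x) (E x) * frag_cmul (?g y) (E y))"
    by (intro sum.cong refl) (simp add: frag_cmul_mult assms)
  also have "\<dots> = frag_extend E f * frag_extend E g"
    by (simp add: frag_extend_def sum_product)
  finally show ?thesis .
qed

lemma lookup_frag_extend:
  "Poly_Mapping.lookup (frag_extend E f) y
    = (\<Sum>x\<in>Poly_Mapping.keys f. Poly_Mapping.lookup f x * Poly_Mapping.lookup (E x) y)"
  by (simp add: frag_extend_def lookup_sum)

lemma act_frag_extend: "act w f = frag_extend (frag_of \<circ> w) f"
proof -
  have "Poly_Mapping.single (w x) c = frag_cmul c (frag_of (w x))" for x and c :: int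
    by (intro poly_mapping_eqI) (simp add: lookup_single when_def)
  then show ?thesis unfolding act_def frag_extend_def o_def by (intro sum.cong refl)
qed

lemma act_frag_of: "act w (frag_of x) = frag_of (w x)"
  by (simp add: act_frag_extend)

lemma act_sum: "finite I \<Longrightarrow> act w (sum f I) = (\<Sum>i\<in>I. act w (f i))"
  by (simp add: act_frag_extend frag_extend_sum o_def)

lemma act_mult:
  assumes "linear w"
  shows "act w (f * g) = act w f * act w g"
  unfolding act_frag_extend
  by (rule frag_extend_mult) (simp add: frag_of_mult linear_add[OF assms])

lemma act_one:
  assumes "linear w"
  shows "act w 1 = 1"
  using act_frag_of[of w 0] by (simp add: frag_of_zero linear_0[OF assms])

lemma act_power: "linear w \<Longrightarrow> act w (f ^ n) = act w f ^ n"
  by (induction n) (auto simp: act_one act_mult)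

lemma act_prod: "linear w \<Longrightarrow> act w (prod f I) = (\<Prod>i\<in>I. act w (f i))"
  by (induction I rule: infinite_finite_induct) (auto simp: act_one act_mult)

lemma lookup_act:
  assumes "inj w"
  shows "Poly_Mapping.lookup (act w f) (w x) = Poly_Mapping.lookup f x"
proof -
  have "Poly_Mapping.lookup (act w f) (w x)
      = (\<Sum>y\<in>Poly_Mapping.keys f. if x = y then Poly_Mapping.lookup f y else 0)"
    unfolding act_frag_extend lookup_frag_extend
    by (rule sum.cong) (auto simp: inj_eq[OF assms])
  also have "\<dots> = Poly_Mapping.lookup f x"
    by (auto simp: in_keys_iff)
  finally show ?thesis .
qed

context simple_roots
begin

text \<open>The polynomial is monic with top exponent \<open>m\<close> for the dominance
  order.\<close>

definition leading :: "('a \<Rightarrow>\<^sub>0 int) \<Rightarrow> 'a \<Rightarrow> bool" where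
  "leading f m \<longleftrightarrow> Poly_Mapping.lookup f m = 1 \<and> (\<forall>x\<in>Poly_Mapping.keys f. m - x \<in> nat_cone \<Delta>)"

lemma leading_frag_of: "leading (frag_of m) m"
  by (simp add: leading_def nat_cone_zero)

text \<open>The cone is pointed, so the exponent \<open>m + n\<close> of the product arises only
  from the two leading terms.\<close>

lemma leading_mult:
  assumes "leading f m" "leading g n"
  shows "leading (f * g) (m + n)"
proof -
  let ?f = "f - frag_of m" and ?g = "g - frag_of n"
  let ?K = Poly_Mapping.keys
  have f: "?K ?f \<subseteq> ?K f - {m}" and g: "?K ?g \<subseteq> ?K g - {n}"
    using assms by (auto simp: leading_def in_keys_iff lookup_minus lookup_single when_def split: if_splits)
  have m: "?K (frag_of m) \<subseteq> ?K f" and n: "?K (frag_of n) \<subseteq> ?K g"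
    using assms by (auto simp: leading_def in_keys_iff)
  \<comment> \<open>By \<open>no\<close> below, none of the last three summands has
    \<open>m + n\<close> in its support.\<close>
  have split: "f * g = frag_of (m + n) + frag_of m * ?g + ?f * frag_of n + ?f * ?g"
    by (simp add: frag_of_mult[symmetric] algebra_simps)
  have no: "m = x \<and> n = y" if "x \<in> ?K f" "y \<in> ?K g" "m + n = x + y" for x y
  proof -
    have *: "m - x = - (n - y)" using that(3) by (simp add: algebra_simps)
    moreover have "m - x \<in> nat_cone \<Delta>" "n - y \<in> nat_cone \<Delta>"
      using assms that by (auto simp: leading_def)
    ultimately have "m - x = 0" using cone_pointed by (metis minus_minus)
    then show ?thesis using * by simp
  qed
  have "m + n \<notin> ?K (frag_of m * ?g)" "m + n \<notin> ?K (?f * frag_of n)" "m + n \<notin> ?K (?f * ?g)"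
    using keys_mult[of "frag_of m" ?g] keys_mult[of ?f "frag_of n"] keys_mult[of ?f ?g] f g m n no
    by blast+
  then have "Poly_Mapping.lookup (f * g) (m + n) = 1"
    by (subst split) (simp add: lookup_add in_keys_iff)
  moreover have "m + n - z \<in> nat_cone \<Delta>" if z: "z \<in> ?K (f * g)" for z
  proof -
    obtain x y where "z = x + y" "x \<in> ?K f" "y \<in> ?K g" using z keys_mult by blast
    moreover from this have "(m - x) + (n - y) \<in> nat_cone \<Delta>"
      using assms by (intro nat_cone_add) (auto simp: leading_def)
    ultimately show ?thesis by (simp add: algebra_simps)
  qed
  ultimately show ?thesis by (simp add: leading_def)
qed

lemma leading_one: "leading 1 0"
  using leading_frag_of[of 0] by (simp add: frag_of_zero)

lemma leading_power:
  assumes "leading f m"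
  shows "leading (f ^ k) (of_nat k *\<^sub>R m)"
  using assms by (induction k) (auto simp: leading_one leading_mult scaleR_add_left)

lemma leading_prod:
  assumes "\<And>i. i \<in> I \<Longrightarrow> leading (f i) (m i)"
  shows "leading (prod f I) (sum m I)"
  using assms by (induction I rule: infinite_finite_induct) (auto simp: leading_one leading_mult)

section \<open>Orbit sums, fundamental weights and images of monomials\<close>

text \<open>Summing over the orbit as a set, rather than over \<open>W\<close>, keeps the
  coefficient of \<open>x\<close> equal to 1 when \<open>x\<close> has a nontrivial
  stabilizer.\<close>

definition orbit_sum :: "'a \<Rightarrow> 'a \<Rightarrow>\<^sub>0 int" where
  "orbit_sum x = (\<Sum>y\<in>(\<lambda>w. w x) ` W. frag_of y)"

lemma act_orbit_sum:
  assumes "w \<in> W"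
  shows "act w (orbit_sum x) = orbit_sum x"
proof -
  obtain u where u: "u \<in> W" "\<And>v. u (w v) = v" "\<And>v. w (u v) = v"
    using W_inverse[OF assms] by blast
  have "act w (orbit_sum x) = (\<Sum>y\<in>(\<lambda>w. w x) ` W. frag_of (w y))"
    unfolding orbit_sum_def using finite_W by (simp add: act_sum act_frag_of)
  also have "\<dots> = orbit_sum x"
    unfolding orbit_sum_def
  proof (rule sum.reindex_bij_witness[of _ u w])
    show "w y \<in> (\<lambda>w. w x) ` W" if "y \<in> (\<lambda>w. w x) ` W" for y
      using that W_compose[OF assms] comp_apply by (smt (verit) image_iff)
    show "u y \<in> (\<lambda>w. w x) ` W" if "y \<in> (\<lambda>w. w x) ` W" for y
      using that W_compose[OF u(1)] comp_apply by (smt (verit) image_iff)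
  qed (auto simp: u)
  finally show ?thesis .
qed

lemma leading_orbit_sum:
  assumes "\<And>a. a \<in> \<Delta> \<Longrightarrow> pairing x a \<in> \<nat>"
  shows "leading (orbit_sum x) x"
proof -
  let ?O = "(\<lambda>w. w x) ` W"
  have fin: "finite ?O" using finite_W by simp
  have *: "Poly_Mapping.lookup (orbit_sum x) z = (if z \<in> ?O then 1 else 0)" for z
    unfolding orbit_sum_def lookup_sum lookup_frag_of using fin by (simp add: sum.delta)
  have "x \<in> ?O" using image_eqI[OF _ W_id, of x "\<lambda>w. w x"] by simp
  then show ?thesis
    using dominant_weight_maximal[OF assms]
    by (auto simp: leading_def * in_keys_iff split: if_splits)
qed

text \<open>The factor turns duality to the simple roots into duality to the simple coroots. Any
  choice of \<open>dual\<close> serves, as only pairings with simple roots matter.\<close>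

definition fundamental_weight :: "'a \<Rightarrow> 'a" where
  "fundamental_weight a = ((a \<bullet> a) / 2) *\<^sub>R dual a"

lemma pairing_fundamental_weight:
  "a \<in> \<Delta> \<Longrightarrow> b \<in> \<Delta> \<Longrightarrow> pairing (fundamental_weight a) b = (if a = b then 1 else 0)"
  using simple_nonzero[of b] inner_dual[of a b]
  by (auto simp: fundamental_weight_def pairing_def inner_commute)

text \<open>An exponent has to be a natural number; on \<open>dominant_weights\<close> the rounding
  changes nothing.\<close>

definition fundamental_multiplicity :: "'a \<Rightarrow> 'a \<Rightarrow> nat" where
  "fundamental_multiplicity m a = nat \<lfloor>pairing m a\<rfloor>"

definition fixed_part :: "'a \<Rightarrow> 'a" where
  "fixed_part m = m - (\<Sum>a\<in>\<Delta>. pairing m a *\<^sub>R fundamental_weight a)"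

text \<open>The fundamental weights need not lie in the lattice,
  so the factors live in the semigroup ring of the whole vector space.\<close>

definition monomial_image :: "'a \<Rightarrow> 'a \<Rightarrow>\<^sub>0 int" where
  "monomial_image m =
     frag_of (fixed_part m) * (\<Prod>a\<in>\<Delta>. orbit_sum (fundamental_weight a) ^ fundamental_multiplicity m a)"

definition dominant_weights :: "'a set" where
  "dominant_weights = {m. \<forall>a\<in>\<Delta>. pairing m a \<in> \<nat>}"

lemma monomial_image_zero: "monomial_image 0 = 1"
  by (simp add: monomial_image_def fixed_part_def fundamental_multiplicity_def frag_of_zero)

text \<open>Rounding is additive here because all pairings are natural numbers.\<close>

lemma monomial_image_add:
  assumes "m \<in> dominant_weights" "n \<in> dominant_weights"
  shows "monomial_image (m + n) = monomial_image m * monomial_image n"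
proof -
  have "fixed_part (m + n) = fixed_part m + fixed_part n"
    by (simp add: fixed_part_def pairing_add scaleR_add_left sum.distrib)
  moreover have "fundamental_multiplicity (m + n) a = fundamental_multiplicity m a + fundamental_multiplicity n a" if "a \<in> \<Delta>" for a
  proof -
    have "pairing m a \<in> \<nat>" "pairing n a \<in> \<nat>"
      using assms that by (auto simp: dominant_weights_def)
    then obtain k l where k: "pairing m a = of_nat k" and l: "pairing n a = of_nat l"
      by (metis Nats_cases)
    then have "pairing (m + n) a = of_nat (k + l)"
      by (simp add: pairing_add)
    then show ?thesis
      unfolding fundamental_multiplicity_def k l by (simp del: of_nat_add)
  qed
  then have "(\<Prod>a\<in>\<Delta>. orbit_sum (fundamental_weight a) ^ fundamental_multiplicity (m + n) a)
    = (\<Prod>a\<in>\<Delta>. orbit_sum (fundamental_weight a) ^ fundamental_multiplicity m a)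
      * (\<Prod>a\<in>\<Delta>. orbit_sum (fundamental_weight a) ^ fundamental_multiplicity n a)"
    unfolding prod.distrib[symmetric] by (intro prod.cong) (auto simp: power_add)
  ultimately show ?thesis
    by (simp add: monomial_image_def frag_of_mult[symmetric] algebra_simps)
qed

text \<open>Leading exponents add under multiplication, and the fixed part together with the
  weighted fundamental weights gives back \<open>m\<close>.\<close>

lemma leading_monomial_image:
  assumes "m \<in> dominant_weights"
  shows "leading (monomial_image m) m"
proof -
  have "leading (monomial_image m)
      (fixed_part m + (\<Sum>a\<in>\<Delta>. of_nat (fundamental_multiplicity m a) *\<^sub>R fundamental_weight a))"
    unfolding monomial_image_def
    by (intro leading_mult leading_frag_of leading_prod leading_power leading_orbit_sum)
      (simp add: pairing_fundamental_weight)
  moreover have "(\<Sum>a\<in>\<Delta>. of_nat (fundamental_multiplicity m a) *\<^sub>R fundamental_weight a)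
      = (\<Sum>a\<in>\<Delta>. pairing m a *\<^sub>R fundamental_weight a)"
  proof (rule sum.cong)
    fix a assume "a \<in> \<Delta>"
    then have "pairing m a \<in> \<nat>" using assms by (simp add: dominant_weights_def)
    then obtain k where "pairing m a = of_nat k" by (metis Nats_cases)
    then show "of_nat (fundamental_multiplicity m a) *\<^sub>R fundamental_weight a = pairing m a *\<^sub>R fundamental_weight a"
      by (simp add: fundamental_multiplicity_def)
  qed simp
  ultimately show ?thesis by (simp add: fixed_part_def)
qed

lemma W_fixes:
  assumes "\<And>a. a \<in> \<Delta> \<Longrightarrow> pairing x a = 0" "w \<in> W"
  shows "w x = x"
  using assms(2) unfolding W_eq
  by induction (auto simp: reflection_pairing assms(1))

text \<open>Every factor is invariant: the fixed part pairs to zero with all simple roots, and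
  \<open>W\<close> permutes each orbit.\<close>

lemma act_monomial_image:
  assumes "w \<in> W"
  shows "act w (monomial_image m) = monomial_image m"
proof -
  have "pairing (fixed_part m) a = 0" if "a \<in> \<Delta>" for a
  proof -
    have "(\<Sum>b\<in>\<Delta>. pairing m b * pairing (fundamental_weight b) a)
        = (\<Sum>b\<in>\<Delta>. if b = a then pairing m b else 0)"
      using that by (intro sum.cong) (auto simp: pairing_fundamental_weight)
    then show ?thesis
      using that finite_simple
      by (simp add: fixed_part_def pairing_diff pairing_sum pairing_scaleR)
  qed
  then have "w (fixed_part m) = fixed_part m" using W_fixes assms by blast
  then show ?thesis
    unfolding monomial_image_def
    by (simp add: act_mult[OF W_linear[OF assms]] act_prod[OF W_linear[OF assms]]
        act_power[OF W_linear[OF assms]] act_frag_of act_orbit_sum[OF assms])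
qed

end

subsection \<open>The isomorphism for a crystallographic simple system\<close>

text \<open>Here \<open>\<Delta>\<close> stands for the rescaled simple roots, which lie in
  \<open>M\<close> and pair integrally with it.\<close>

locale invariant_semigroup = simple_roots \<Delta> W
  for \<Delta> :: "'a::euclidean_space set" and W :: "('a \<Rightarrow> 'a) set" +
  fixes M S :: "'a set"
  assumes M_diff: "x \<in> M \<Longrightarrow> y \<in> M \<Longrightarrow> x - y \<in> M"
    and simple_in_M: "\<Delta> \<subseteq> M"
    and pairing_int: "m \<in> M \<Longrightarrow> a \<in> \<Delta> \<Longrightarrow> pairing m a \<in> \<int>"
    and M_discrete: "finite (M \<inter> cball 0 r)"
    and S_subset: "S \<subseteq> M"
    and S_zero: "0 \<in> S"
    and S_add: "x \<in> S \<Longrightarrow> y \<in> S \<Longrightarrow> x + y \<in> S"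
    and S_saturated: "m \<in> M \<Longrightarrow> k > 0 \<Longrightarrow> of_nat k *\<^sub>R m \<in> S \<Longrightarrow> m \<in> S"
    and S_invariant: "w \<in> W \<Longrightarrow> x \<in> S \<Longrightarrow> w x \<in> S"
begin

abbreviation D where "D \<equiv> fundamental_domain \<Delta>"

lemma S_scale: "x \<in> S \<Longrightarrow> of_nat k *\<^sub>R x \<in> S"
  by (induction k) (auto simp: scaleR_add_left S_zero S_add)

lemma dominant_pairing_nat:
  assumes "m \<in> M" "a \<in> \<Delta>" "m \<bullet> a \<ge> 0"
  shows "pairing m a \<in> \<nat>"
  using pairing_int[OF assms(1,2)] pairing_nonneg_iff[OF simple_nonzero[OF assms(2)], of m] assms(3)
  by (simp add: Nats_altdef2)

lemma dominant_weights_D: "D \<inter> S \<subseteq> dominant_weights"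
  using S_subset dominant_pairing_nat by (auto simp: fundamental_domain_def dominant_weights_def)

text \<open>Since \<open>p (x - a) = (p - 1) x + s\<^sub>a x\<close> for \<open>p = \<langle>x, a\<^sup>\<or>\<rangle>\<close>, saturation allows one to
  subtract from \<open>x\<close> a simple root \<open>a\<close> with \<open>p > 0\<close>.\<close>

lemma subtract_simple_root:
  assumes x: "x \<in> S" and a: "a \<in> \<Delta>" and pos: "x \<bullet> a > 0"
  shows "x - a \<in> S"
proof -
  obtain p where p: "pairing x a = of_nat p"
    using dominant_pairing_nat[of x a] x S_subset a pos Nats_cases by (metis less_imp_le subsetD)
  have "pairing x a > 0"
    using pos simple_nonzero[OF a] by (simp add: pairing_def)
  then have "p > 0" using p by simp
  then have "of_nat p *\<^sub>R (x - a) = of_nat (p - 1) *\<^sub>R x + reflection a x"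
    by (simp add: reflection_pairing p of_nat_diff algebra_simps)
  then have "of_nat p *\<^sub>R (x - a) \<in> S"
    using S_add S_scale S_invariant W_reflection a x by metis
  then show ?thesis
    using S_saturated \<open>p > 0\<close> M_diff x a S_subset simple_in_M by blast
qed

text \<open>Induction on the sum of the coefficients of \<open>z = x - u\<close>. As
  \<open>z \<bullet> z > 0\<close>, some simple root \<open>a\<close> occurs in \<open>z\<close> and
  satisfies \<open>z \<bullet> a > 0\<close>. Dominance of \<open>u\<close> gives
  \<open>(u + z) \<bullet> a > 0\<close>, so subtracting \<open>a\<close> stays in
  \<open>S\<close>.\<close>

lemma dominated_in_S:
  assumes u: "u \<in> D" and "x - u \<in> nat_cone \<Delta>" "x \<in> S"
  shows "u \<in> S"
proof -
  obtain n :: "'a \<Rightarrow> nat" where "x - u = (\<Sum>a\<in>\<Delta>. of_nat (n a) *\<^sub>R a)"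
    using assms(2) unfolding nat_cone_def by blast
  then have "u + (\<Sum>a\<in>\<Delta>. of_nat (n a) *\<^sub>R a) \<in> S"
    using assms(3) by (simp add: algebra_simps)
  then show ?thesis
  proof (induction "sum n \<Delta>" arbitrary: n rule: less_induct)
    case less
    define z where "z = (\<Sum>a\<in>\<Delta>. of_nat (n a) *\<^sub>R a)"
    show ?case
    proof (cases "z = 0")
      case True
      then show ?thesis using less.prems z_def by simp
    next
      case False
      have zz: "z \<bullet> z = (\<Sum>a\<in>\<Delta>. of_nat (n a) * (z \<bullet> a))"
        by (subst (2) z_def) (simp add: inner_sum_right)
      have "\<exists>a\<in>\<Delta>. real (n a) * (z \<bullet> a) > 0"
      proof (rule ccontr)
        assume "\<not> ?thesis"
        then have "z \<bullet> z \<le> 0" unfolding zz by (intro sum_nonpos) (simp add: not_less)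
        then show False using False by (metis inner_gt_zero_iff not_le)
      qed
      then obtain a where a: "a \<in> \<Delta>" "real (n a) * (z \<bullet> a) > 0" by blast
      then have pos: "n a > 0" "z \<bullet> a > 0"
        by (auto simp: zero_less_mult_iff)
      have "u \<bullet> a \<ge> 0" using u a by (auto simp: fundamental_domain_def)
      then have "u + z - a \<in> S"
        using subtract_simple_root[of "u + z" a] less.prems a pos z_def by (simp add: inner_add_left)
      define n' where "n' = n(a := n a - 1)"
      have rest: "sum n' (\<Delta> - {a}) = sum n (\<Delta> - {a})"
        "(\<Sum>b\<in>\<Delta> - {a}. of_nat (n' b) *\<^sub>R b) = (\<Sum>b\<in>\<Delta> - {a}. of_nat (n b) *\<^sub>R b)"
        by (auto simp: n'_def intro: sum.cong)
      have "sum n' \<Delta> < sum n \<Delta>"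
        using pos by (simp add: sum.remove[OF finite_simple a(1)] rest) (simp add: n'_def)
      moreover have "(\<Sum>b\<in>\<Delta>. of_nat (n' b) *\<^sub>R b) = z - a"
        using pos unfolding z_def
        by (simp add: sum.remove[OF finite_simple a(1)] rest)
          (simp add: n'_def of_nat_diff algebra_simps)
      ultimately show ?thesis
        using less.hyps[of n'] \<open>u + z - a \<in> S\<close> by (simp only: add_diff_eq)
    qed
  qed
qed

lemma lookup_invariant:
  assumes "w \<in> W" "act w f = f"
  shows "Poly_Mapping.lookup f (w x) = Poly_Mapping.lookup f x"
  using lookup_act[of w f x] W_orthogonal[OF assms(1)] assms(2) orthogonal_transformation_inj
  by force

text \<open>The support is stable under \<open>W\<close>, so an exponent can be moved into
  \<open>D\<close>, where it is dominated by \<open>m\<close> and hence lies in \<open>S\<close>;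
  invariance of \<open>S\<close> brings it back.\<close>

lemma keys_monomial_image:
  assumes m: "m \<in> D \<inter> S"
  shows "Poly_Mapping.keys (monomial_image m) \<subseteq> S"
proof
  fix x assume x: "x \<in> Poly_Mapping.keys (monomial_image m)"
  obtain w where w: "w \<in> W" "\<And>a. a \<in> \<Delta> \<Longrightarrow> w x \<bullet> a \<ge> 0"
    using dominant_conjugate by blast
  have "w x \<in> Poly_Mapping.keys (monomial_image m)"
    using x lookup_invariant[OF w(1) act_monomial_image[OF w(1)]] by (simp add: in_keys_iff)
  then have "m - w x \<in> nat_cone \<Delta>"
    using leading_monomial_image m dominant_weights_D by (auto simp: leading_def)
  then have "w x \<in> S"
    using dominated_in_S[of "w x" m] w m by (auto simp: fundamental_domain_def)
  then show "x \<in> S"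
    using W_inverse[OF w(1)] S_invariant by metis
qed

section \<open>Unitriangularity and bijectivity\<close>

definition toric_iso :: "('a \<Rightarrow>\<^sub>0 int) \<Rightarrow> ('a \<Rightarrow>\<^sub>0 int)" where
  "toric_iso = frag_extend monomial_image"

text \<open>Unitriangularity: a dominant exponent of \<open>monomial_image k\<close> other than
  \<open>k\<close> is strictly shorter than \<open>k\<close>.\<close>

lemma lookup_monomial_image_top:
  assumes k: "k \<in> D \<inter> S" and m: "m \<in> D" and "norm k \<le> norm m"
  shows "Poly_Mapping.lookup (monomial_image k) m = (if k = m then 1 else 0)"
proof -
  have lead: "leading (monomial_image k) k"
    using leading_monomial_image dominant_weights_D k by blast
  show ?thesis
  proof (cases "k = m")
    case True
    then show ?thesis using lead by (simp add: leading_def)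
  next
    case False
    have "m \<notin> Poly_Mapping.keys (monomial_image k)"
      using norm_less_of_dominance[of m k] lead m False assms(3)
      by (force simp: leading_def fundamental_domain_def)
    then show ?thesis using False by (simp add: in_keys_iff)
  qed
qed

lemma lookup_toric_iso_top:
  assumes "Poly_Mapping.keys f \<subseteq> D \<inter> S" "m \<in> D" "\<And>k. k \<in> Poly_Mapping.keys f \<Longrightarrow> norm k \<le> norm m"
  shows "Poly_Mapping.lookup (toric_iso f) m = Poly_Mapping.lookup f m"
proof -
  have "Poly_Mapping.lookup (toric_iso f) m
      = (\<Sum>k\<in>Poly_Mapping.keys f. if k = m then Poly_Mapping.lookup f k else 0)"
    unfolding toric_iso_def lookup_frag_extend
  proof (rule sum.cong)
    fix k assume k: "k \<in> Poly_Mapping.keys f"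
    then have "Poly_Mapping.lookup (monomial_image k) m = (if k = m then 1 else 0)"
      using assms by (intro lookup_monomial_image_top) auto
    then show "Poly_Mapping.lookup f k * Poly_Mapping.lookup (monomial_image k) m
        = (if k = m then Poly_Mapping.lookup f k else 0)" by simp
  qed simp
  also have "\<dots> = Poly_Mapping.lookup f m"
    by (auto simp: in_keys_iff)
  finally show ?thesis .
qed

lemma toric_iso_eq_0:
  assumes "Poly_Mapping.keys f \<subseteq> D \<inter> S" "toric_iso f = 0"
  shows "f = 0"
proof (rule ccontr)
  assume "f \<noteq> 0"
  \<comment> \<open>At a longest exponent \<open>f\<close> and \<open>toric_iso f\<close> have the
    same coefficient.\<close>
  then obtain m where m: "m \<in> Poly_Mapping.keys f"
    "\<And>k. k \<in> Poly_Mapping.keys f \<Longrightarrow> norm k \<le> norm m"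
    using ex_is_arg_min_if_finite[OF finite_keys, of f "\<lambda>k. - norm k"]
    by (auto simp: is_arg_min_linorder)
  then have "Poly_Mapping.lookup f m = 0"
    using lookup_toric_iso_top[of f m] assms by auto
  then show False using m(1) by (simp add: in_keys_iff)
qed

lemma toric_iso_inj: "inj_on toric_iso (semigroup_ring (D \<inter> S))"
proof (rule inj_onI)
  fix f g assume *: "f \<in> semigroup_ring (D \<inter> S)" "g \<in> semigroup_ring (D \<inter> S)" "toric_iso f = toric_iso g"
  then have "toric_iso (f - g) = 0" by (simp add: toric_iso_def frag_extend_diff)
  moreover have "Poly_Mapping.keys (f - g) \<subseteq> D \<inter> S"
    using * keys_diff[of f g] by (auto simp: semigroup_ring_def)
  ultimately have "f - g = 0" by (rule toric_iso_eq_0[rotated])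
  then show "f = g" by simp
qed

lemma act_frag_cmul: "act w (frag_cmul c f) = frag_cmul c (act w f)"
  by (simp add: act_frag_extend frag_extend_cmul)

lemma toric_iso_invariant:
  assumes "f \<in> semigroup_ring (D \<inter> S)"
  shows "toric_iso f \<in> invariants W (semigroup_ring S)"
proof -
  have f: "Poly_Mapping.keys f \<subseteq> D \<inter> S" using assms by (simp add: semigroup_ring_def)
  then have "Poly_Mapping.keys (toric_iso f) \<subseteq> S"
    unfolding toric_iso_def using keys_frag_extend keys_monomial_image by fast
  moreover have "act w (toric_iso f) = toric_iso f" if "w \<in> W" for w
    unfolding toric_iso_def by (subst (1 2) frag_extend_def)
      (simp add: act_sum act_frag_cmul act_monomial_image[OF that])
  ultimately show ?thesis by (simp add: invariants_def semigroup_ring_def)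
qed

text \<open>Leading-term elimination by induction on a finite set \<open>X\<close> containing the
  dominant exponents of \<open>f\<close>. Subtracting a multiple of \<open>monomial_image m\<close>
  for a longest \<open>m\<close> in \<open>X\<close> removes \<open>m\<close>; the dominant
  exponents that this may add are shorter than \<open>m\<close>, hence already in
  \<open>X\<close>.\<close>

lemma toric_iso_surj_aux:
  assumes "finite X" "X \<subseteq> D \<inter> S" "\<And>u x. u \<in> X \<Longrightarrow> x \<in> D \<inter> S \<Longrightarrow> norm x < norm u \<Longrightarrow> x \<in> X"
    and "f \<in> invariants W (semigroup_ring S)" "Poly_Mapping.keys f \<inter> D \<subseteq> X"
  shows "f \<in> toric_iso ` semigroup_ring (D \<inter> S)"
  using assms
proof (induction X arbitrary: f rule: finite_psubset_induct)
  case (psubset X)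
  show ?case
  proof (cases "X = {}")
    case True
    \<comment> \<open>An invariant element without dominant exponents has no exponents at all, as
      every orbit meets \<open>D\<close>.\<close>
    have "x \<notin> Poly_Mapping.keys f" for x
    proof
      assume x: "x \<in> Poly_Mapping.keys f"
      obtain w where w: "w \<in> W" "\<And>a. a \<in> \<Delta> \<Longrightarrow> w x \<bullet> a \<ge> 0"
        using dominant_conjugate by blast
      then have "w x \<in> Poly_Mapping.keys f \<inter> D"
        using x lookup_invariant[OF w(1), of f x] psubset.prems(3)
        by (auto simp: in_keys_iff invariants_def fundamental_domain_def)
      then show False using True psubset.prems by blast
    qed
    then have "f = toric_iso 0" unfolding toric_iso_def by (metis frag_extend_0 all_not_in_conv keys_eq_empty)
    then show ?thesis by (auto simp: semigroup_ring_def)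
  next
    case False
    then obtain m where m: "m \<in> X" "\<And>k. k \<in> X \<Longrightarrow> norm k \<le> norm m"
      using ex_is_arg_min_if_finite[OF psubset.hyps(1), of "\<lambda>k. - norm k"]
      by (auto simp: is_arg_min_linorder)
    then have mA: "m \<in> D \<inter> S" using psubset.prems by blast
    let ?c = "Poly_Mapping.lookup f m"
    define f' where "f' = f - frag_cmul ?c (monomial_image m)"
    have lead: "leading (monomial_image m) m"
      using leading_monomial_image dominant_weights_D mA by blast
    have "f' \<in> toric_iso ` semigroup_ring (D \<inter> S)"
    proof (rule psubset.IH[of "X - {m}"])
      show "X - {m} \<subset> X" "X - {m} \<subseteq> D \<inter> S" using m psubset.prems by auto
      \<comment> \<open>Since \<open>m\<close> is longest in \<open>X\<close>, removing it keeps
        \<open>X\<close> closed under passing to shorter elements.\<close>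
      show "x \<in> X - {m}" if "u \<in> X - {m}" "x \<in> D \<inter> S" "norm x < norm u" for u x
        using that psubset.prems(2)[of u x] m by force
      have K: "Poly_Mapping.keys f' \<subseteq> Poly_Mapping.keys f \<union> Poly_Mapping.keys (monomial_image m)"
        unfolding f'_def
        using keys_diff[of f "frag_cmul ?c (monomial_image m)"] keys_cmul[of ?c "monomial_image m"]
        by blast
      moreover have "act w f' = f'" if "w \<in> W" for w
      proof -
        have "act w f' = act w f - frag_cmul ?c (act w (monomial_image m))"
          unfolding f'_def act_frag_extend by (simp add: frag_extend_diff frag_extend_cmul)
        then show ?thesis
          using that psubset.prems(3) by (simp add: act_monomial_image invariants_def f'_def)
      qed
      ultimately show "f' \<in> invariants W (semigroup_ring S)"
        using keys_monomial_image[OF mA] psubset.prems(3)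
        by (auto simp: invariants_def semigroup_ring_def)
      show "Poly_Mapping.keys f' \<inter> D \<subseteq> X - {m}"
      proof
        fix x assume x: "x \<in> Poly_Mapping.keys f' \<inter> D"
        have "x \<noteq> m"
          using x lead by (auto simp: f'_def leading_def in_keys_iff lookup_minus)
        moreover have "x \<in> X" if "x \<in> Poly_Mapping.keys (monomial_image m)"
        proof -
          have "norm x < norm m"
            using norm_less_of_dominance[of x m] x that lead \<open>x \<noteq> m\<close>
            by (auto simp: leading_def fundamental_domain_def)
          moreover have "x \<in> D \<inter> S" using x that keys_monomial_image[OF mA] by blast
          ultimately show ?thesis using psubset.prems(2) m(1) by blast
        qed
        ultimately show "x \<in> X - {m}" using x K psubset.prems(4) by blast
      qed
    qed
    then obtain g where g: "g \<in> semigroup_ring (D \<inter> S)" "f' = toric_iso g" by blast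
    have "f = toric_iso (g + frag_cmul ?c (frag_of m))"
      using g(2) by (simp add: toric_iso_def frag_extend_add frag_extend_cmul f'_def algebra_simps)
    moreover have "g + frag_cmul ?c (frag_of m) \<in> semigroup_ring (D \<inter> S)"
      using g(1) mA keys_add[of g "frag_cmul ?c (frag_of m)"] keys_cmul[of ?c "frag_of m"]
      by (auto simp: semigroup_ring_def)
    ultimately show ?thesis by blast
  qed
qed

lemma toric_iso_surj:
  assumes "f \<in> invariants W (semigroup_ring S)"
  shows "f \<in> toric_iso ` semigroup_ring (D \<inter> S)"
proof -
  obtain r where r: "Poly_Mapping.keys f \<subseteq> cball 0 r"
    using finite_imp_bounded[OF finite_keys, of f] by (force simp: bounded_iff)
  show ?thesis
  proof (rule toric_iso_surj_aux[OF _ _ _ assms])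
    show "finite (D \<inter> S \<inter> cball 0 r)"
      by (rule finite_subset[OF _ M_discrete[of r]]) (use S_subset in auto)
    show "Poly_Mapping.keys f \<inter> D \<subseteq> D \<inter> S \<inter> cball 0 r"
      using r assms by (auto simp: invariants_def semigroup_ring_def)
  qed auto
qed

lemma ring_iso_betw_toric_iso:
  "ring_iso_betw toric_iso (semigroup_ring (D \<inter> S)) (invariants W (semigroup_ring S))"
  unfolding ring_iso_betw_def
proof (intro conjI ballI)
  show "bij_betw toric_iso (semigroup_ring (D \<inter> S)) (invariants W (semigroup_ring S))"
    unfolding bij_betw_def using toric_iso_inj toric_iso_invariant toric_iso_surj by blast
  show "toric_iso 1 = 1"
    using frag_extend_of[of monomial_image 0]
    by (simp add: toric_iso_def frag_of_zero monomial_image_zero)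
  fix f g assume fg: "f \<in> semigroup_ring (D \<inter> S)" "g \<in> semigroup_ring (D \<inter> S)"
  show "toric_iso (f + g) = toric_iso f + toric_iso g"
    by (simp add: toric_iso_def frag_extend_add)
  show "toric_iso (f * g) = toric_iso f * toric_iso g"
    unfolding toric_iso_def
    by (rule frag_extend_mult, rule monomial_image_add)
      (use fg dominant_weights_D in \<open>auto simp: semigroup_ring_def\<close>)
qed

end

subsection \<open>Lattices and primitive roots\<close>

lemma lattice_combination:
  assumes "is_lattice M" "x \<in> M" "y \<in> M"
  shows "of_int k *\<^sub>R x + of_int l *\<^sub>R y \<in> M"
proof -
  obtain B where M: "M = {v. \<exists>c::'a \<Rightarrow> int. v = (\<Sum>b\<in>B. of_int (c b) *\<^sub>R b)}"
    using assms(1) unfolding is_lattice_def by blast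
  obtain c d :: "'a \<Rightarrow> int" where
    "x = (\<Sum>b\<in>B. of_int (c b) *\<^sub>R b)" "y = (\<Sum>b\<in>B. of_int (d b) *\<^sub>R b)"
    using assms M by auto
  then have "of_int k *\<^sub>R x + of_int l *\<^sub>R y = (\<Sum>b\<in>B. of_int (k * c b + l * d b) *\<^sub>R b)"
    by (simp add: scaleR_sum_right sum.distrib scaleR_add_left)
  then show ?thesis unfolding M by (intro CollectI exI[of _ "\<lambda>b. k * c b + l * d b"])
qed

lemma lattice_diff: "is_lattice M \<Longrightarrow> x \<in> M \<Longrightarrow> y \<in> M \<Longrightarrow> x - y \<in> M"
  using lattice_combination[of M x y 1 "-1"] by simp

text \<open>Coordinates are bounded linear functionals, so on a ball the integer coordinates lie in
  a finite box.\<close>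

lemma lattice_finite_cball:
  assumes "is_lattice M"
  shows "finite (M \<inter> cball 0 r)"
proof -
  obtain B where B: "independent B" "span B = UNIV"
    and M: "M = {v. \<exists>c::'a \<Rightarrow> int. v = (\<Sum>b\<in>B. of_int (c b) *\<^sub>R b)}"
    using assms unfolding is_lattice_def by blast
  have finB: "finite B" using B(1) by (rule independent_imp_finite)
  have "\<exists>K. \<forall>v. norm (representation B v b) \<le> norm v * K" for b
    using bounded_linear.bounded[OF bounded_linear_representation[OF B]] .
  then obtain K where K: "\<And>b v. norm (representation B v b) \<le> norm v * K b" by metis
  define N where "N b = \<lceil>\<bar>r\<bar> * \<bar>K b\<bar>\<rceil>" for b
  have "M \<inter> cball 0 r \<subseteq> (\<lambda>c. \<Sum>b\<in>B. of_int (c b) *\<^sub>R b) ` (\<Pi>\<^sub>E b\<in>B. {- N b..N b})"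
  proof
    fix v assume v: "v \<in> M \<inter> cball 0 r"
    then obtain c :: "'a \<Rightarrow> int" where c: "v = (\<Sum>b\<in>B. of_int (c b) *\<^sub>R b)" using M by blast
    have "restrict c B \<in> (\<Pi>\<^sub>E b\<in>B. {- N b..N b})"
    proof (intro restrict_PiE_iff[THEN iffD2] ballI)
      fix b assume b: "b \<in> B"
      have "representation B v b = (\<Sum>b'\<in>B. of_int (c b') * representation B b' b)"
        unfolding c by (simp add: representation_sum[OF B(1)] representation_scale[OF B(1)] B(2))
      also have "\<dots> = (\<Sum>b'\<in>B. if b' = b then of_int (c b') else 0)"
        by (intro sum.cong) (auto simp: representation_basis[OF B(1)])
      finally have "representation B v b = of_int (c b)" using b finB by simp
      then have "\<bar>of_int (c b)\<bar> \<le> norm v * K b" using K[of v b] by simp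
      also have "\<dots> \<le> norm v * \<bar>K b\<bar>" by (intro mult_left_mono) auto
      also have "\<dots> \<le> \<bar>r\<bar> * \<bar>K b\<bar>" using v by (intro mult_right_mono) auto
      also have "\<dots> \<le> of_int (N b)" by (simp add: N_def)
      finally show "c b \<in> {- N b..N b}" by auto
    qed
    moreover have "v = (\<Sum>b\<in>B. of_int (restrict c B b) *\<^sub>R b)"
      unfolding c by (intro sum.cong) auto
    ultimately show "v \<in> (\<lambda>c. \<Sum>b\<in>B. of_int (c b) *\<^sub>R b) ` (\<Pi>\<^sub>E b\<in>B. {- N b..N b})"
      by blast
  qed
  then show ?thesis
    by (rule finite_subset) (intro finite_imageI finite_PiE finB finite_atLeastAtMost_int)
qed

text \<open>A spanning set is not contained in the hyperplane orthogonal to \<open>a\<close>. This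
  provides a nonzero lattice vector on the line of a root.\<close>

lemma lattice_not_orthogonal:
  assumes "is_lattice M" "a \<noteq> 0"
  obtains m where "m \<in> M" "m \<bullet> a \<noteq> 0"
proof -
  obtain B where B: "independent B" "span B = UNIV"
    and M: "M = {v. \<exists>c::'a \<Rightarrow> int. v = (\<Sum>b\<in>B. of_int (c b) *\<^sub>R b)}"
    using assms unfolding is_lattice_def by blast
  have finB: "finite B" using B(1) by (rule independent_imp_finite)
  have "\<exists>b\<in>B. b \<bullet> a \<noteq> 0"
  proof (rule ccontr)
    assume "\<not> ?thesis"
    then have "span B \<subseteq> {x. a \<bullet> x = 0}"
      by (intro span_minimal subspace_hyperplane) (auto simp: inner_commute)
    then have "a \<bullet> a = 0" using B(2) by blast
    then show False using assms(2) by simp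
  qed
  then obtain b where b: "b \<in> B" "b \<bullet> a \<noteq> 0" by blast
  have "(\<Sum>x\<in>B. of_int (if x = b then 1 else 0) *\<^sub>R x) = (\<Sum>x\<in>B. if x = b then x else 0)"
    by (intro sum.cong) auto
  then have "b = (\<Sum>x\<in>B. of_int (if x = b then 1 else 0) *\<^sub>R x)" using b finB by simp
  then have "b \<in> M" unfolding M by (intro CollectI exI[of _ "\<lambda>x. if x = b then 1 else 0"])
  then show ?thesis using that b by blast
qed

text \<open>The primitive lattice vector on the line of a root: for \<open>m \<in> M\<close>, the vector
  \<open>m - s\<^sub>a m = \<langle>m, a\<^sup>\<or>\<rangle> a\<close> lies in \<open>M\<close>, hence is an integral multiple of it.\<close>

lemma primitive_multiple:
  fixes a :: "'a::euclidean_space"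
  assumes M: "is_lattice M" and a: "a \<noteq> 0" and refl: "reflection a ` M \<subseteq> M"
  obtains t where "t > 0" "t *\<^sub>R a \<in> M" "\<And>m. m \<in> M \<Longrightarrow> pairing m (t *\<^sub>R a) \<in> \<int>"
proof -
  have pair: "pairing m a *\<^sub>R a \<in> M" if "m \<in> M" for m
  proof -
    have "m - reflection a m \<in> M" using lattice_diff[OF M] refl that by blast
    then show ?thesis by (simp add: reflection_pairing)
  qed
  obtain m0 where m0: "m0 \<in> M" "m0 \<bullet> a \<noteq> 0" using lattice_not_orthogonal[OF M a] by blast
  define p where "p = \<bar>pairing m0 a\<bar>"
  have "p > 0" using m0 a by (simp add: p_def pairing_def)
  have "- (pairing m0 a *\<^sub>R a) \<in> M"
    using lattice_combination[OF M pair[OF m0(1)] pair[OF m0(1)], of "-1" 0] by simp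
  then have "p *\<^sub>R a \<in> M" using pair[OF m0(1)] by (simp add: p_def abs_if)
  \<comment> \<open>The bound by \<open>p\<close> makes \<open>L\<close> finite, so that it has a
    least element.\<close>
  define L where "L = {t. 0 < t \<and> t \<le> p \<and> t *\<^sub>R a \<in> M}"
  have "finite L"
  proof (rule finite_imageD)
    have "norm (t *\<^sub>R a) \<le> p * norm a" if "t \<in> L" for t
      using that mult_right_mono[of t p "norm a"] by (simp add: L_def)
    then show "finite ((\<lambda>t. t *\<^sub>R a) ` L)"
      by (intro finite_subset[OF _ lattice_finite_cball[OF M, of "p * norm a"]])
        (auto simp: L_def)
    show "inj_on (\<lambda>t. t *\<^sub>R a) L" using a by (auto simp: inj_on_def)
  qed
  moreover have "p \<in> L" using \<open>p > 0\<close> \<open>p *\<^sub>R a \<in> M\<close> by (simp add: L_def)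
  ultimately obtain t where t: "t \<in> L" "\<And>u. u \<in> L \<Longrightarrow> t \<le> u"
    by (metis Min_in Min_le empty_iff)
  then have pos: "t > 0" and "t *\<^sub>R a \<in> M" "t \<le> p" by (auto simp: L_def)
  have "pairing m (t *\<^sub>R a) \<in> \<int>" if m: "m \<in> M" for m
  proof -
    define q where "q = pairing m a"
    \<comment> \<open>Division with remainder: the remainder \<open>q - k t\<close> is nonnegative
      and below \<open>t\<close>, so minimality of \<open>t\<close> makes it zero.\<close>
    define k where "k = \<lfloor>q / t\<rfloor>"
    have "q *\<^sub>R a \<in> M" using pair[OF m] q_def by simp
    then have "(q - of_int k * t) *\<^sub>R a \<in> M"
      using lattice_combination[OF M _ \<open>t *\<^sub>R a \<in> M\<close>, of "q *\<^sub>R a" 1 "- k"]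
      by (simp add: scaleR_diff_left)
    moreover have "of_int k * t \<le> q" "q < (of_int k + 1) * t"
      using pos by (auto simp: k_def floor_divide_lower floor_divide_upper)
    moreover from this have "q - of_int k * t < t" by (simp add: algebra_simps)
    ultimately have "q = of_int k * t"
      using t(2)[of "q - of_int k * t"] \<open>t \<le> p\<close> unfolding L_def by force
    then have "q / t = of_int k" using pos by simp
    moreover have "pairing m (t *\<^sub>R a) = q / t"
      using pos by (simp add: q_def pairing_def field_simps)
    ultimately show ?thesis by simp
  qed
  then show ?thesis using that pos \<open>t *\<^sub>R a \<in> M\<close> by blast
qed

subsection \<open>Simple reflections and rescaled simple systems\<close>

lemma simple_system_dual:
  assumes "simple_system \<Phi> \<Delta>" "\<beta> \<in> \<Phi>"
    and d: "\<And>a b. a \<in> \<Delta> \<Longrightarrow> b \<in> \<Delta> \<Longrightarrow> b \<bullet> d a = (if a = b then 1 else 0)"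
  shows "\<beta> = (\<Sum>a\<in>\<Delta>. (\<beta> \<bullet> d a) *\<^sub>R a)"
    and "(\<forall>a\<in>\<Delta>. \<beta> \<bullet> d a \<ge> 0) \<or> (\<forall>a\<in>\<Delta>. \<beta> \<bullet> d a \<le> 0)"
proof -
  have fin: "finite \<Delta>" using assms(1) independent_imp_finite by (auto simp: simple_system_def)
  obtain c where c: "\<beta> = (\<Sum>a\<in>\<Delta>. c a *\<^sub>R a)"
    "(\<forall>a\<in>\<Delta>. c a \<ge> 0) \<or> (\<forall>a\<in>\<Delta>. c a \<le> 0)"
    using assms(1,2) unfolding simple_system_def by blast
  have *: "\<beta> \<bullet> d a = c a" if a: "a \<in> \<Delta>" for a
  proof -
    have "\<beta> \<bullet> d a = (\<Sum>b\<in>\<Delta>. if b = a then c b else 0)"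
      unfolding c(1) inner_sum_left by (intro sum.cong) (auto simp: d a)
    then show ?thesis using a fin by simp
  qed
  show "\<beta> = (\<Sum>a\<in>\<Delta>. (\<beta> \<bullet> d a) *\<^sub>R a)" by (subst c(1), intro sum.cong) (auto simp: *)
  show "(\<forall>a\<in>\<Delta>. \<beta> \<bullet> d a \<ge> 0) \<or> (\<forall>a\<in>\<Delta>. \<beta> \<bullet> d a \<le> 0)" using c(2) by (simp add: *)
qed

text \<open>A positive root that is not proportional to a simple one is moved by some simple reflection
  to a positive root of smaller height.\<close>

lemma simple_reflections_generate:
  assumes \<Phi>: "root_system \<Phi>" and \<Delta>: "simple_system \<Phi> \<Delta>"
  shows "gen_group (reflection ` \<Phi>) = gen_group (reflection ` \<Delta>)"
proof
  show "gen_group (reflection ` \<Delta>) \<subseteq> gen_group (reflection ` \<Phi>)"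
    using \<Delta> by (intro gen_group_mono) (auto simp: simple_system_def intro: gen_group_base)
next
  have fin: "finite \<Phi>" "finite \<Delta>" and ind: "independent \<Delta>" and sub: "\<Delta> \<subseteq> \<Phi>"
    using \<Phi> \<Delta> finite_subset by (auto simp: root_system_def simple_system_def)
  obtain d where d: "\<And>a b. a \<in> \<Delta> \<Longrightarrow> b \<in> \<Delta> \<Longrightarrow> b \<bullet> d a = (if a = b then 1 else 0)"
    using dual_family_exists[OF ind] by blast
  note coef = simple_system_dual[OF \<Delta> _ d, simplified]
  define rho where "rho = (\<Sum>a\<in>\<Delta>. d a)"
  have rho: "a \<bullet> rho = 1" if "a \<in> \<Delta>" for a
    unfolding rho_def inner_sum_right using that fin by (simp add: d)
  have nz: "\<beta> \<noteq> 0" if "\<beta> \<in> \<Phi>" for \<beta> using that \<Phi> by (auto simp: root_system_def)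
  have pos: "reflection \<beta> \<in> gen_group (reflection ` \<Delta>)"
    if "\<beta> \<in> \<Phi>" "\<forall>a\<in>\<Delta>. \<beta> \<bullet> d a \<ge> 0" for \<beta>
    using that
  \<comment> \<open>Heights are real numbers, so the induction counts the roots of smaller height
    instead.\<close>
  proof (induction "card {\<gamma>\<in>\<Phi>. \<gamma> \<bullet> rho < \<beta> \<bullet> rho}" arbitrary: \<beta> rule: less_induct)
    case less
    have bb: "\<beta> \<bullet> \<beta> = (\<Sum>a\<in>\<Delta>. (\<beta> \<bullet> d a) * (\<beta> \<bullet> a))"
      by (subst (2) coef(1)[OF less.prems(1)]) (simp add: inner_sum_right)
    have "\<exists>a\<in>\<Delta>. (\<beta> \<bullet> d a) * (\<beta> \<bullet> a) > 0"
    proof (rule ccontr)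
      assume "\<not> ?thesis"
      then have "\<beta> \<bullet> \<beta> \<le> 0" unfolding bb by (intro sum_nonpos) (simp add: not_less)
      then show False using nz[OF less.prems(1)] by (metis inner_gt_zero_iff not_le)
    qed
    then obtain a where a: "a \<in> \<Delta>" "(\<beta> \<bullet> d a) * (\<beta> \<bullet> a) > 0" by blast
    then have "\<beta> \<bullet> a > 0" "\<beta> \<bullet> d a > 0"
      using less.prems(2) by (auto simp: zero_less_mult_iff dest: leD)
    show ?case
    proof (cases "\<exists>c\<in>\<Delta>. c \<noteq> a \<and> \<beta> \<bullet> d c \<noteq> 0")
      case False
      then have "\<beta> = (\<Sum>c\<in>\<Delta>. if c = a then (\<beta> \<bullet> d a) *\<^sub>R a else 0)"
        by (subst coef(1)[OF less.prems(1)], intro sum.cong) auto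
      then have "\<beta> = (\<beta> \<bullet> d a) *\<^sub>R a" using a fin by simp
      then have "reflection \<beta> = reflection a"
        using \<open>\<beta> \<bullet> d a > 0\<close> reflection_scaleR by (metis less_irrefl)
      then show ?thesis using a by (auto intro: gen_group_base)
    next
      case True
      then obtain c where c: "c \<in> \<Delta>" "c \<noteq> a" "\<beta> \<bullet> d c > 0"
        using less.prems(2) by (metis order_le_less)
      define \<gamma> where "\<gamma> = reflection a \<beta>"
      have "\<gamma> \<in> \<Phi>" using \<Phi> sub a less.prems(1) unfolding \<gamma>_def root_system_def by blast
      \<comment> \<open>The coefficient at \<open>c\<close> is unaffected by
        \<open>reflection a\<close>; one positive coefficient makes the whole root positive.\<close>
      moreover have "\<gamma> \<bullet> d c > 0"
        using c a by (simp add: \<gamma>_def reflection_pairing inner_diff_left d)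
      ultimately have "\<forall>a\<in>\<Delta>. \<gamma> \<bullet> d a \<ge> 0" using coef(2) c by (meson not_le)
      have "pairing \<beta> a > 0"
        using \<open>\<beta> \<bullet> a > 0\<close> nz sub a by (auto simp: pairing_def)
      then have ht: "\<gamma> \<bullet> rho < \<beta> \<bullet> rho"
        by (simp add: \<gamma>_def reflection_pairing inner_diff_left rho[OF a(1)])
      have "card {\<delta>\<in>\<Phi>. \<delta> \<bullet> rho < \<gamma> \<bullet> rho} < card {\<delta>\<in>\<Phi>. \<delta> \<bullet> rho < \<beta> \<bullet> rho}"
        by (rule psubset_card_mono) (use fin ht \<open>\<gamma> \<in> \<Phi>\<close> in auto)
      then have "reflection \<gamma> \<in> gen_group (reflection ` \<Delta>)"
        using less.hyps \<open>\<gamma> \<in> \<Phi>\<close> \<open>\<forall>a\<in>\<Delta>. \<gamma> \<bullet> d a \<ge> 0\<close> by blast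
      moreover have "reflection \<beta> = reflection a \<circ> (reflection \<gamma> \<circ> reflection a)"
        using reflection_conjugate[OF orthogonal_reflection[of a], of \<gamma>] by (auto simp: \<gamma>_def)
      ultimately show ?thesis
        using a by (auto intro!: gen_group_compose intro: gen_group_base simp del: o_apply)
    qed
  qed
  have "reflection \<beta> \<in> gen_group (reflection ` \<Delta>)" if \<beta>: "\<beta> \<in> \<Phi>" for \<beta>
  proof (cases "\<forall>a\<in>\<Delta>. \<beta> \<bullet> d a \<ge> 0")
    case True
    then show ?thesis using pos \<beta> by blast
  next
    case False
    then have "\<forall>a\<in>\<Delta>. \<beta> \<bullet> d a \<le> 0" using coef(2)[OF \<beta>] by blast
    then have "\<forall>a\<in>\<Delta>. - \<beta> \<bullet> d a \<ge> 0" by simp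
    moreover have "- \<beta> \<in> \<Phi>" using \<Phi> \<beta> unfolding root_system_def by blast
    moreover have "reflection (- \<beta>) = reflection \<beta>" using reflection_scaleR[of "-1" \<beta>] by simp
    ultimately show ?thesis using pos by metis
  qed
  then show "gen_group (reflection ` \<Phi>) \<subseteq> gen_group (reflection ` \<Delta>)"
    by (intro gen_group_mono) auto
qed

lemma gen_group_preserves_roots:
  assumes "root_system \<Phi>" "w \<in> gen_group (reflection ` \<Phi>)" "\<beta> \<in> \<Phi>"
  shows "w \<beta> \<in> \<Phi>"
  using assms(2,3)
proof (induction arbitrary: \<beta>)
  case (gen_comp g h)
  then obtain a where "a \<in> \<Phi>" "g = reflection a" "h \<beta> \<in> \<Phi>" by blast
  then show ?case using assms(1) unfolding root_system_def o_apply by blast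
qed simp

section \<open>Rescaled simple systems\<close>

lemma independent_scale:
  assumes "independent B" "\<And>b. b \<in> B \<Longrightarrow> t b \<noteq> 0"
  shows "independent ((\<lambda>b. t b *\<^sub>R b) ` (B :: 'a::euclidean_space set))"
proof -
  have fin: "finite B" using assms(1) by (rule independent_imp_finite)
  let ?B = "(\<lambda>b. t b *\<^sub>R b) ` B"
  have "b \<in> span ?B" if "b \<in> B" for b
  proof -
    have "(1 / t b) *\<^sub>R (t b *\<^sub>R b) \<in> span ?B"
      using that by (intro span_scale span_base) auto
    then show ?thesis using assms(2)[OF that] by simp
  qed
  then have "B \<subseteq> span ?B" by blast
  then have "dim B \<le> dim (span ?B)" by (rule dim_subset)
  moreover have "card ?B \<le> card B" using fin by (rule card_image_le)
  ultimately show ?thesis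
    using fin dim_eq_card_independent[OF assms(1)]
    by (intro card_le_dim_spanning[of _ "span ?B"]) (auto intro: span_base)
qed

lemma nat_coefficients_in_nat_cone:
  assumes "v = (\<Sum>b\<in>B. c b *\<^sub>R b)" "\<And>b. b \<in> B \<Longrightarrow> c b \<in> \<nat>"
  shows "v \<in> nat_cone B"
proof -
  have "v = (\<Sum>b\<in>B. of_nat (nat \<lfloor>c b\<rfloor>) *\<^sub>R b)"
    unfolding assms(1)
  proof (intro sum.cong refl)
    fix b assume "b \<in> B"
    then obtain n where "c b = of_nat n" using assms(2) Nats_cases by metis
    then show "c b *\<^sub>R b = of_nat (nat \<lfloor>c b\<rfloor>) *\<^sub>R b" by simp
  qed
  then show ?thesis unfolding nat_cone_def by (intro CollectI exI[of _ "\<lambda>b. nat \<lfloor>c b\<rfloor>"])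
qed

text \<open>Integrality and sign come from different sources. Coefficients in the rescaled basis are
  integers because the Cartan numbers are, and they share a sign because \<open>w a\<close> is a
  positive multiple of a root.\<close>

lemma scaled_simple_system_signed:
  assumes \<Phi>: "root_system \<Phi>" and \<Delta>: "simple_system \<Phi> \<Delta>"
    and t: "\<And>a. a \<in> \<Delta> \<Longrightarrow> t a > 0"
    and cartan: "\<And>a b. a \<in> (\<lambda>a. t a *\<^sub>R a) ` \<Delta> \<Longrightarrow> b \<in> (\<lambda>a. t a *\<^sub>R a) ` \<Delta> \<Longrightarrow> pairing a b \<in> \<int>"
    and w: "w \<in> gen_group (reflection ` \<Delta>)" and a: "a \<in> (\<lambda>a. t a *\<^sub>R a) ` \<Delta>"
  shows "w a \<in> nat_cone ((\<lambda>a. t a *\<^sub>R a) ` \<Delta>) \<or> - w a \<in> nat_cone ((\<lambda>a. t a *\<^sub>R a) ` \<Delta>)"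
proof -
  let ?B = "(\<lambda>a. t a *\<^sub>R a) ` \<Delta>"
  have sub: "\<Delta> \<subseteq> \<Phi>" and ind: "independent \<Delta>" using \<Delta> by (auto simp: simple_system_def)
  have indB: "independent ?B" using t by (intro independent_scale ind) force
  then have finB: "finite ?B" by (rule independent_imp_finite)
  obtain d where d: "\<And>b c. b \<in> ?B \<Longrightarrow> c \<in> ?B \<Longrightarrow> c \<bullet> d b = (if b = c then 1 else 0)"
    using dual_family_exists[OF indB] by blast
  have refl_eq: "reflection ` \<Delta> = reflection ` ?B"
    unfolding image_image by (intro image_cong refl) (simp add: reflection_scaleR less_imp_neq[OF t, THEN not_sym])

  \<comment> \<open>The integral pairings are carried along because a further reflection changes the
    coefficients by just such a pairing.\<close>
  have "w a = (\<Sum>b\<in>?B. (w a \<bullet> d b) *\<^sub>R b) \<and> (\<forall>b\<in>?B. w a \<bullet> d b \<in> \<int> \<and> pairing (w a) b \<in> \<int>)"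
    using w unfolding refl_eq
  proof induction
    case gen_id
    have "(\<Sum>b\<in>?B. (a \<bullet> d b) *\<^sub>R b) = (\<Sum>b\<in>?B. if b = a then a else 0)"
      by (intro sum.cong refl) (use a d in auto)
    then show ?case using a finB d[OF _ a] cartan[OF a] by simp
  next
    case (gen_comp g h)
    then obtain c where c: "c \<in> ?B" "g = reflection c" by blast
    define k where "k = pairing (h a) c"
    have k: "k \<in> \<int>" unfolding k_def using gen_comp.IH c(1) by blast
    have ga: "(g \<circ> h) a = h a - k *\<^sub>R c" by (simp add: c reflection_pairing k_def)
    have dual: "(g \<circ> h) a \<bullet> d b = h a \<bullet> d b - (if b = c then k else 0)" if "b \<in> ?B" for b
      unfolding ga using d[OF that c(1)] by (simp add: inner_diff_left)
    have "(\<Sum>b\<in>?B. ((g \<circ> h) a \<bullet> d b) *\<^sub>R b) = (\<Sum>b\<in>?B. (h a \<bullet> d b) *\<^sub>R b - (if b = c then k *\<^sub>R c else 0))"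
    proof (intro sum.cong refl)
      fix b assume b: "b \<in> ?B"
      show "((g \<circ> h) a \<bullet> d b) *\<^sub>R b = (h a \<bullet> d b) *\<^sub>R b - (if b = c then k *\<^sub>R c else 0)"
        unfolding dual[OF b] by (simp add: scaleR_diff_left)
    qed
    also have "\<dots> = h a - k *\<^sub>R c"
      using gen_comp.IH c finB by (simp add: sum_subtractf)
    finally show ?case
      using gen_comp.IH k c cartan[OF c(1)] dual ga
      by (auto simp: pairing_diff pairing_scaleR intro!: Ints_diff Ints_mult)
  qed
  then have wa: "w a = (\<Sum>b\<in>?B. (w a \<bullet> d b) *\<^sub>R b)" and int: "\<And>b. b \<in> ?B \<Longrightarrow> w a \<bullet> d b \<in> \<int>"
    by blast+

  obtain e where e: "e \<in> \<Delta>" "a = t e *\<^sub>R e" using a by blast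
  have "w \<in> gen_group (reflection ` \<Phi>)"
    using w simple_reflections_generate[OF \<Phi> \<Delta>] by simp
  then have "w e \<in> \<Phi>" using gen_group_preserves_roots[OF \<Phi>] e sub by blast
  then obtain c where c: "w e = (\<Sum>x\<in>\<Delta>. c x *\<^sub>R x)" "(\<forall>x\<in>\<Delta>. c x \<ge> 0) \<or> (\<forall>x\<in>\<Delta>. c x \<le> 0)"
    using \<Delta> unfolding simple_system_def by blast
  have "linear w" using w gen_group_reflection_orthogonal orthogonal_transformation_linear by blast
  then have "w a = t e *\<^sub>R w e" using e by (simp add: linear_scale)
  then have coef: "w a \<bullet> d b = t e * (\<Sum>x\<in>\<Delta>. c x * (x \<bullet> d b))" for b
    by (simp add: c(1) inner_sum_left)
  have nonneg: "x \<bullet> d b \<ge> 0" if "x \<in> \<Delta>" "b \<in> ?B" for x b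
  proof -
    have "t x * (x \<bullet> d b) \<ge> 0" using d[OF that(2), of "t x *\<^sub>R x"] that(1) by auto
    then show ?thesis using t[OF that(1)] by (simp add: zero_le_mult_iff)
  qed
  from c(2) show ?thesis
  proof
    assume "\<forall>x\<in>\<Delta>. c x \<ge> 0"
    then have "w a \<bullet> d b \<ge> 0" if "b \<in> ?B" for b
      unfolding coef using nonneg that t[OF e(1)] by (intro mult_nonneg_nonneg sum_nonneg) auto
    then have "w a \<in> nat_cone ?B"
      using wa int by (intro nat_coefficients_in_nat_cone) (auto simp: Nats_altdef2)
    then show ?thesis by blast
  next
    assume *: "\<forall>x\<in>\<Delta>. c x \<le> 0"
    have "w a \<bullet> d b \<le> 0" if "b \<in> ?B" for b
      unfolding coef using nonneg that t[OF e(1)] *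
      by (intro mult_nonneg_nonpos sum_nonpos mult_nonpos_nonneg) auto
    moreover have "- w a = (\<Sum>b\<in>?B. (- (w a \<bullet> d b)) *\<^sub>R b)"
      by (subst wa) (simp add: sum_negf)
    ultimately have "- w a \<in> nat_cone ?B"
      using int by (intro nat_coefficients_in_nat_cone[where c = "\<lambda>b. - (w a \<bullet> d b)"])
        (simp_all add: Nats_altdef2)
    then show ?thesis by blast
  qed
qed

theorem theorem1p2:
  fixes M :: "'a::euclidean_space set"
    and W :: "('a \<Rightarrow> 'a) set"
    and \<Phi> \<Delta> S :: "'a set"
  assumes "is_lattice M"
    and "root_system \<Phi>"
    and "W = gen_group (reflection ` \<Phi>)"
    and "finite W"
    and "\<forall>w\<in>W. w ` M = M"
    and "simple_system \<Phi> \<Delta>"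
    and "saturated_affine_semigroup M S"
    and "\<forall>w\<in>W. w ` S = S"
  shows "\<exists>\<phi> :: ('a \<Rightarrow>\<^sub>0 int) \<Rightarrow> ('a \<Rightarrow>\<^sub>0 int).
           ring_iso_betw \<phi> (semigroup_ring (fundamental_domain \<Delta> \<inter> S))
                           (invariants W (semigroup_ring S))"
proof -
  have sub: "\<Delta> \<subseteq> \<Phi>" and ind: "independent \<Delta>"
    using assms(6) by (auto simp: simple_system_def)
  have nz: "a \<noteq> 0" if "a \<in> \<Delta>" for a using that ind dependent_zero by blast
  have "\<exists>t>0. t *\<^sub>R a \<in> M \<and> (\<forall>m\<in>M. pairing m (t *\<^sub>R a) \<in> \<int>)" if a: "a \<in> \<Delta>" for a
  proof -
    have "reflection a \<in> W" unfolding assms(3) using a sub by (intro gen_group_base) auto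
    then have "reflection a ` M \<subseteq> M" using assms(5) by blast
    then obtain t where "t > 0" "t *\<^sub>R a \<in> M" "\<And>m. m \<in> M \<Longrightarrow> pairing m (t *\<^sub>R a) \<in> \<int>"
      using primitive_multiple[OF assms(1) nz[OF a]] by blast
    then show ?thesis by blast
  qed
  then obtain t where t: "\<And>a. a \<in> \<Delta> \<Longrightarrow> t a > 0" "\<And>a. a \<in> \<Delta> \<Longrightarrow> t a *\<^sub>R a \<in> M"
    "\<And>a m. a \<in> \<Delta> \<Longrightarrow> m \<in> M \<Longrightarrow> pairing m (t a *\<^sub>R a) \<in> \<int>"
    by metis
  define B where "B = (\<lambda>a. t a *\<^sub>R a) ` \<Delta>"
  \<comment> \<open>Rescaling the roots leaves their reflections, and hence the group,
    unchanged.\<close>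
  have refl_eq: "reflection ` B = reflection ` \<Delta>"
    unfolding B_def image_image
    by (intro image_cong refl) (simp add: reflection_scaleR less_imp_neq[OF t(1), THEN not_sym])
  have W: "W = gen_group (reflection ` B)"
    using assms(3) simple_reflections_generate[OF assms(2,6)] refl_eq by simp
  have BM: "B \<subseteq> M" using t(2) by (auto simp: B_def)
  have int: "pairing m b \<in> \<int>" if "m \<in> M" "b \<in> B" for m b
    using that t(3) by (auto simp: B_def)
  obtain G where G: "S = nat_cone G"
    using assms(7) unfolding saturated_affine_semigroup_def nat_cone_def by blast
  interpret invariant_semigroup B W M S
  proof
    show "independent B" unfolding B_def using t(1) by (intro independent_scale ind) force
    show "w a \<in> nat_cone B \<or> - w a \<in> nat_cone B" if "w \<in> W" "a \<in> B" for w a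
    proof (rule scaled_simple_system_signed[where t = t and w = w and a = a, OF assms(2,6) t(1), folded B_def])
      show "pairing x y \<in> \<int>" if "x \<in> B" "y \<in> B" for x y using that int BM by blast
      show "w \<in> gen_group (reflection ` \<Delta>)" using that W refl_eq by simp
    qed (use that in auto)
    show "finite (M \<inter> cball 0 r)" for r by (rule lattice_finite_cball[OF assms(1)])
    show "x - y \<in> M" if "x \<in> M" "y \<in> M" for x y using lattice_diff assms(1) that by blast
    show "S \<subseteq> M" using assms(7) by (simp add: saturated_affine_semigroup_def)
    show "m \<in> S" if "m \<in> M" "k > 0" "of_nat k *\<^sub>R m \<in> S" for m k
      using assms(7) that by (auto simp: saturated_affine_semigroup_def)
    show "0 \<in> S" by (simp add: G nat_cone_zero)
    show "x + y \<in> S" if "x \<in> S" "y \<in> S" for x y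
      using that by (simp add: G nat_cone_add)
    show "w x \<in> S" if "w \<in> W" "x \<in> S" for w x using assms(8) that by blast
  qed (use W assms(4) BM int in auto)
  \<comment> \<open>The scaling factors are positive, so the defining inequalities are
    equivalent.\<close>
  have "fundamental_domain \<Delta> = fundamental_domain B"
    using t(1) by (force simp: fundamental_domain_def B_def zero_le_mult_iff)
  then show ?thesis using ring_iso_betw_toric_iso by metis
qed

end
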